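(* Let $X(t)=E(t)X_0+\int_0^tE(t-s)\,\mathrm dW(s)$, $t\ge0$, be the mild solution of $\mathrm dX+A^2X\,\mathrm dt=\mathrm dW$, $t>0$, $X(0)=X_0$, with $X_0\in L_2(\Omega,\dot H^{\beta})$ and $\|A^{\frac{\beta-2}{2}}Q^{\frac12}\|_{\mathrm{HS}}<\infty$ for some $\beta\ge0$. Then there is a constant $C$, independent of $t$, $X_0$ and $Q$, such that $$\|X(t)\|_{L_2(\Omega,\dot H^{\beta})}\le C\Big(\|X_0\|_{L_2(\Omega,\dot H^{\beta})}+\|A^{\frac{\beta-2}{2}}Q^{\frac12}\|_{\mathrm{HS}}\Big),\quad t\ge0.$$ Moreover, if $\beta=0$, then for the norm in $H$ we have, with a constant $C$ independent of $t$ and $X_0$ (but possibly depending on $Q$), $$\|X(t)\|_{L_2(\Omega,H)}\le C\Big(\|X_0\|_{L_2(\Omega,H)}+\|A^{-1}Q^{\frac12}\|_{\mathrm{HS}}+t^{\frac12}\Big),\quad t\ge0.$$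
   Context: $\mathcal D\subset\mathbf R^d$, $d\le 3$, is a bounded domain with sufficiently smooth boundary. $H=L_2(\mathcal D)$ with norm $\|\cdot\|$ and inner product $(\cdot,\cdot)$; $H^s=H^s(\mathcal D)$ are the usual Sobolev spaces. $\dot H=\{v\in H:(v,1)=0\}$ and $P:H\to\dot H$ is the orthogonal projector. $A=-\Delta$ with domain $D(A)=\{v\in H^2:\partial v/\partial n=0\text{ on }\partial\mathcal D\}$ ($\partial/\partial n$ is the outward normal derivative). $A$ is selfadjoint and positive definite on $\dot H$ with compact inverse; on $H$ it has an orthonormal eigenbasis $\{\varphi_j\}_{j\ge0}$ with eigenvalues $0=\lambda_0<\lambda_1\le\lambda_2\le\cdots\to\infty$, and $\varphi_0=|\mathcal D|^{-1/2}$ is constant. For $s\in\mathbf R$, $|v|_s=\|A^{s/2}Pv\|=\big(\sum_{j\ge1}\lambda_j^s(v,\varphi_j)^2\big)^{1/2}$ (a seminorm when applied to elements not orthogonal to constants). For $s\ge0$, $\dot H^s=\{v\in\dot H:|v|_s<\infty\}$; for $s<0$, $\dot H^s$ is the closure (completion) of $\dot H$ with respect to $|\cdot|_s$. $E(t)=\mathrm e^{-tA^2}$ is the analytic semigroup generated by $-A^2$: $E(t)v=\sum_{j\ge0}\mathrm e^{-t\lambda_j^2}(v,\varphi_j)\varphi_j$. $(\Omega,\mathcal F,\mathbf P,\{\mathcal F_t\}_{t\ge0})$ is a filtered probability space, $Q$ is a selfadjoint, positive semidefinite, bounded linear operator on $H$, and $\{W(t)\}_{t\ge0}$ is a $Q$-Wiener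 process on $H$ adapted to $\{\mathcal F_t\}$ (cylindrical if $Q$ is not of trace class; $Q=I$ is allowed). $\int_0^t\cdots\mathrm dW(s)$ is the $H$-valued It\^o integral. $\|X\|_{L_2(\Omega,\dot H^{\beta})}=(\mathbf E\{|X|_{\beta}^2\})^{1/2}$, and $\|X\|_{L_2(\Omega,H)}=(\mathbf E\{\|X\|^2\})^{1/2}$. The Hilbert–Schmidt norm is $\|T\|_{\mathrm{HS}}^2=\sum_{l=1}^\infty\|T\phi_l\|^2$ for an arbitrary orthonormal basis $\{\phi_l\}$ of $H$; powers of $A$ are understood as $A^{s/2}P$, so $\|A^{\frac{\beta-2}{2}}Q^{1/2}\|_{\mathrm{HS}}^2=\sum_l|Q^{1/2}\phi_l|_{\beta-2}^2$. *)

theory Defs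
  imports "HOL-Probability.Probability"
begin

section \<open>Domains with smooth boundary\<close>

fun C_k_on :: "nat \<Rightarrow> ('a::euclidean_space \<Rightarrow> real) \<Rightarrow> 'a set \<Rightarrow> bool" where
  "C_k_on 0 f U \<longleftrightarrow> continuous_on U f"
| "C_k_on (Suc k) f U \<longleftrightarrow>
     (\<exists>grad. (\<forall>x\<in>U. GDERIV f x :> grad x) \<and> (\<forall>b\<in>Basis. C_k_on k (\<lambda>x. grad x \<bullet> b) U))"

definition defining_function ::
  "'a::euclidean_space set \<Rightarrow> 'a \<Rightarrow> 'a set \<Rightarrow> ('a \<Rightarrow> real) \<Rightarrow> ('a \<Rightarrow> 'a) \<Rightarrow> bool" where
  "defining_function D x U r grad \<longleftrightarrow>
     open U \<and> x \<in> U \<and> C_k_on 2 r U \<and>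
     (\<forall>y\<in>U. GDERIV r y :> grad y \<and> grad y \<noteq> 0) \<and> D \<inter> U = {y \<in> U. r y < 0}"

(* "Sufficiently smooth" is read as C^2: every smoother class is a special case, and C^2 is enough
   for the H^2-regularity of the Neumann problem. *)
definition smooth_bounded_domain :: "'a::euclidean_space set \<Rightarrow> bool" where
  "smooth_bounded_domain D \<longleftrightarrow>
     open D \<and> connected D \<and> D \<noteq> {} \<and> bounded D \<and>
     (\<forall>x\<in>frontier D. \<exists>U r grad. defining_function D x U r grad)"

definition outward_normal :: "'a::euclidean_space set \<Rightarrow> 'a \<Rightarrow> 'a" where
  "outward_normal D x = (THE n. \<exists>U r grad. defining_function D x U r grad \<and>
                                   n = grad x /\<^sub>R norm (grad x))"

(* The k-dimensional Hausdorff outer measure, without the customary normalising factor, which is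
   irrelevant below: the surface measure enters only through its null sets and through
   L_2-convergence. Empty covering sets must contribute 0 also for k = 0. *)
definition hausdorff_outer :: "nat \<Rightarrow> 'a::euclidean_space set \<Rightarrow> ennreal" where
  "hausdorff_outer k S =
     (SUP \<delta>\<in>{0<..}. INF V\<in>{V :: nat \<Rightarrow> 'a set.
          S \<subseteq> (\<Union>i. V i) \<and> (\<forall>i. bounded (V i) \<and> diameter (V i) \<le> \<delta>)}.
        \<Sum>i. if V i = {} then 0 else ennreal (diameter (V i) ^ k))"

definition surface_measure :: "'a::euclidean_space set \<Rightarrow> 'a measure" where
  "surface_measure D =
     restrict_space (measure_of UNIV (sets borel) (hausdorff_outer (DIM('a) - 1))) (frontier D)"


section \<open>\<open>L\<^sub>2\<close>, Sobolev functions, traces and the Neumann Laplacian\<close>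

definition square_integrable :: "'a::euclidean_space set \<Rightarrow> ('a \<Rightarrow> real) set" where
  "square_integrable D =
     {f \<in> borel_measurable (lebesgue_on D). integrable (lebesgue_on D) (\<lambda>x. (f x)\<^sup>2)}"

(* The Hilbert space 'h is L_2(D): the quotient of the square-integrable functions on D by
   a.e. equality, with "cls f" the class of f. By the formula for the inner product, cls f = cls g
   holds exactly if f = g a.e. on D. Nothing is assumed about cls outside the
   square-integrable functions. *)
definition L2_space ::
  "'a::euclidean_space set \<Rightarrow> (('a \<Rightarrow> real) \<Rightarrow> 'h::real_inner) \<Rightarrow> bool" where
  "L2_space D cls \<longleftrightarrow>
     (\<forall>f\<in>square_integrable D. \<forall>g\<in>square_integrable D.
        cls (\<lambda>x. f x + g x) = cls f + cls g \<and>
        cls f \<bullet> cls g = (LINT x|lebesgue_on D. f x * g x)) \<and>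
     (\<forall>f\<in>square_integrable D. \<forall>c. cls (\<lambda>x. c * f x) = c *\<^sub>R cls f) \<and>
     cls ` square_integrable D = UNIV"

(* g b is the weak partial derivative of f in the coordinate direction b; f and all the g b are
   in L_2(D), so that f is in H^1(D). *)
definition has_weak_gradient ::
  "'a::euclidean_space set \<Rightarrow> ('a \<Rightarrow> real) \<Rightarrow> ('a \<Rightarrow> 'a \<Rightarrow> real) \<Rightarrow> bool" where
  "has_weak_gradient D f g \<longleftrightarrow>
     f \<in> square_integrable D \<and>
     (\<forall>b\<in>Basis. g b \<in> square_integrable D \<and>
       (\<forall>\<psi> grad. (\<forall>k. C_k_on k \<psi> UNIV) \<and> (\<forall>x. GDERIV \<psi> x :> grad x) \<and>
                 (\<exists>K\<subseteq>D. compact K \<and> (\<forall>x. x \<notin> K \<longrightarrow> \<psi> x = 0)) \<longrightarrow>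
          (LINT x|lebesgue_on D. f x * (grad x \<bullet> b)) = - (LINT x|lebesgue_on D. g b x * \<psi> x)))"

(* T is the boundary trace of the H^1(D)-function u: the L_2(frontier D)-limit of the restrictions
   of smooth functions that converge to u in H^1(D). *)
definition has_trace ::
  "'a::euclidean_space set \<Rightarrow> ('a \<Rightarrow> real) \<Rightarrow> ('a \<Rightarrow> real) \<Rightarrow> bool" where
  "has_trace D u T \<longleftrightarrow>
     T \<in> borel_measurable (surface_measure D) \<and>
     (\<exists>g w grad. has_weak_gradient D u g \<and>
        (\<forall>k n. C_k_on k (w n) UNIV) \<and> (\<forall>n x. GDERIV (w n) x :> grad n x) \<and>
        (\<lambda>n::nat. \<integral>\<^sup>+x. ennreal ((w n x - u x)\<^sup>2) \<partial>lebesgue_on D) \<longlonglongrightarrow> 0 \<and>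
        (\<forall>b\<in>Basis.
          (\<lambda>n. \<integral>\<^sup>+x. ennreal ((grad n x \<bullet> b - g b x)\<^sup>2) \<partial>lebesgue_on D) \<longlonglongrightarrow> 0) \<and>
        (\<lambda>n. \<integral>\<^sup>+x. ennreal ((w n x - T x)\<^sup>2) \<partial>surface_measure D) \<longlonglongrightarrow> 0)"

(* The graph of A = -Laplacian with domain {v in H^2(D). dv/dn = 0 on the boundary}; the normal
   derivative is the normal component of the trace T of the weak gradient g. *)
definition neumann_laplacian ::
  "'a::euclidean_space set \<Rightarrow> (('a \<Rightarrow> real) \<Rightarrow> 'h::real_inner) \<Rightarrow> ('h \<times> 'h) set" where
  "neumann_laplacian D cls =
     {(cls f, cls (\<lambda>x. - (\<Sum>b\<in>Basis. h b b x))) | f g h.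
        has_weak_gradient D f g \<and> (\<forall>b\<in>Basis. has_weak_gradient D (g b) (h b)) \<and>
        (\<exists>T. (\<forall>b\<in>Basis. has_trace D (g b) (T b)) \<and>
             (AE x in surface_measure D. (\<Sum>b\<in>Basis. T b x * (outward_normal D x \<bullet> b)) = 0))}"

definition orthonormal_basis :: "(nat \<Rightarrow> 'h::real_inner) \<Rightarrow> bool" where
  "orthonormal_basis e \<longleftrightarrow>
     (\<forall>i j. e i \<bullet> e j = (if i = j then 1 else 0)) \<and> closure (span (range e)) = UNIV"

definition neumann_eigenbasis ::
  "'a::euclidean_space set \<Rightarrow> (('a \<Rightarrow> real) \<Rightarrow> 'h::real_inner) \<Rightarrow> (nat \<Rightarrow> 'h) \<Rightarrow> (nat \<Rightarrow> real) \<Rightarrow> bool"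
  where
  "neumann_eigenbasis D cls \<phi> lam \<longleftrightarrow>
     orthonormal_basis \<phi> \<and> (\<forall>j. (\<phi> j, lam j *\<^sub>R \<phi> j) \<in> neumann_laplacian D cls) \<and>
     \<phi> 0 = cls (\<lambda>x. 1 / sqrt (measure lebesgue D)) \<and>
     lam 0 = 0 \<and> 0 < lam 1 \<and> (\<forall>j\<ge>1. lam j \<le> lam (Suc j)) \<and> filterlim lam at_top sequentially"


section \<open>Norms, semigroup and covariance operators\<close>

definition esqrt :: "ennreal \<Rightarrow> ennreal" where
  "esqrt x = (if x = \<top> then \<top> else ennreal (sqrt (enn2real x)))"

definition H_norm :: "'h::real_normed_vector \<Rightarrow> ennreal" where
  "H_norm v = ennreal (norm v)"

definition Hdot_norm :: "(nat \<Rightarrow> 'h::real_inner) \<Rightarrow> (nat \<Rightarrow> real) \<Rightarrow> real \<Rightarrow> 'h \<Rightarrow> ennreal" where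
  "Hdot_norm \<phi> lam s v = esqrt (\<Sum>j. ennreal (lam (Suc j) powr s * (v \<bullet> \<phi> (Suc j))\<^sup>2))"

(* Only used for s >= 0. *)
definition Hdot ::
  "(('a::euclidean_space \<Rightarrow> real) \<Rightarrow> 'h::real_inner) \<Rightarrow> (nat \<Rightarrow> 'h) \<Rightarrow> (nat \<Rightarrow> real) \<Rightarrow> real \<Rightarrow> 'h set" where
  "Hdot cls \<phi> lam s = {v. v \<bullet> cls (\<lambda>_. 1) = 0 \<and> Hdot_norm \<phi> lam s v < \<top>}"

(* The norm of a random variable X in L_2(Omega, V), where N is the norm of V. *)
definition L2_norm :: "'w measure \<Rightarrow> ('h \<Rightarrow> ennreal) \<Rightarrow> ('w \<Rightarrow> 'h) \<Rightarrow> ennreal" where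
  "L2_norm M N X = esqrt (\<integral>\<^sup>+\<omega>. (N (X \<omega>))\<^sup>2 \<partial>M)"

(* The Hilbert-Schmidt norm of T as an operator into the space with norm N. With
   N = Hdot_norm \<phi> lam s this is the Hilbert-Schmidt norm of A^(s/2) T, also for unbounded A^(s/2).
   The value does not depend on the basis. *)
definition HS_norm :: "('h::real_inner \<Rightarrow> ennreal) \<Rightarrow> ('h \<Rightarrow> 'h) \<Rightarrow> ennreal" where
  "HS_norm N T =
     (let e = (SOME e :: nat \<Rightarrow> 'h. orthonormal_basis e) in esqrt (\<Sum>l. (N (T (e l)))\<^sup>2))"

definition E_semigroup ::
  "(nat \<Rightarrow> 'h::{real_inner,banach}) \<Rightarrow> (nat \<Rightarrow> real) \<Rightarrow> real \<Rightarrow> 'h \<Rightarrow> 'h" where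
  "E_semigroup \<phi> lam t v = (\<Sum>j. exp (- t * (lam j)\<^sup>2) *\<^sub>R ((v \<bullet> \<phi> j) *\<^sub>R \<phi> j))"

definition covariance_operator :: "('h::real_inner \<Rightarrow> 'h) \<Rightarrow> bool" where
  "covariance_operator Q \<longleftrightarrow>
     bounded_linear Q \<and> (\<forall>u v. Q u \<bullet> v = u \<bullet> Q v) \<and> (\<forall>u. 0 \<le> Q u \<bullet> u)"

definition operator_sqrt :: "('h::real_inner \<Rightarrow> 'h) \<Rightarrow> ('h \<Rightarrow> 'h) \<Rightarrow> bool" where
  "operator_sqrt R Q \<longleftrightarrow> covariance_operator R \<and> (\<forall>u. R (R u) = Q u)"


section \<open>Wiener processes, the Ito integral and mild solutions\<close>

definition filtered_prob_space :: "'w measure \<Rightarrow> (real \<Rightarrow> 'w measure) \<Rightarrow> bool" where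
  "filtered_prob_space M F \<longleftrightarrow>
     prob_space M \<and> (\<forall>t\<ge>0. subalgebra M (F t)) \<and>
     (\<forall>s t. 0 \<le> s \<and> s \<le> t \<longrightarrow> subalgebra (F t) (F s))"

definition centered_gaussian :: "'w measure \<Rightarrow> ('w \<Rightarrow> real) \<Rightarrow> real \<Rightarrow> bool" where
  "centered_gaussian M Y v \<longleftrightarrow>
     (if v = 0 then AE \<omega> in M. Y \<omega> = 0
      else distributed M lborel Y (\<lambda>x. ennreal (normal_density 0 (sqrt v) x)))"

(* W t u is the real random variable (W(t), u). If Q is not of trace class, W(t) exists only in
   this cylindrical sense; if Q is of trace class and W is an H-valued Q-Wiener process, then the
   random variables (W(t), u) satisfy these conditions. *)
definition Q_wiener_process ::
  "'w measure \<Rightarrow> (real \<Rightarrow> 'w measure) \<Rightarrow> ('h::real_inner \<Rightarrow> 'h) \<Rightarrow> (real \<Rightarrow> 'h \<Rightarrow> 'w \<Rightarrow> real) \<Rightarrow> bool"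
  where
  "Q_wiener_process M F Q W \<longleftrightarrow>
     (\<forall>t\<ge>0. \<forall>u. W t u \<in> borel_measurable (F t)) \<and>
     (\<forall>t\<ge>0. \<forall>u v a b. AE \<omega> in M. W t (a *\<^sub>R u + b *\<^sub>R v) \<omega> = a * W t u \<omega> + b * W t v \<omega>) \<and>
     (\<forall>u. AE \<omega> in M. W 0 u \<omega> = 0) \<and>
     (\<forall>u. AE \<omega> in M. continuous_on {0..} (\<lambda>t. W t u \<omega>)) \<and>
     (\<forall>s t u. 0 \<le> s \<and> s < t \<longrightarrow>
        centered_gaussian M (\<lambda>\<omega>. W t u \<omega> - W s u \<omega>) ((t - s) * (Q u \<bullet> u)) \<and>
        prob_space.indep_set M (sets (F s))
          (sets (vimage_algebra (space M) (\<lambda>\<omega>. W t u \<omega> - W s u \<omega>) borel)))"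

(* The list entry (a, b, B, u, h) stands for the operator-valued process
   1_(a,b](s) 1_B(omega) (u, .) h, with B in F_a. *)
type_synonym ('h, 'w) elementary = "(real \<times> real \<times> 'w set \<times> 'h \<times> 'h) list"

definition elementary :: "(real \<Rightarrow> 'w measure) \<Rightarrow> ('h, 'w) elementary \<Rightarrow> bool" where
  "elementary F S \<longleftrightarrow> (\<forall>(a, b, B, u, h)\<in>set S. 0 \<le> a \<and> a \<le> b \<and> B \<in> sets (F a))"

definition elementary_process ::
  "('h::real_inner, 'w) elementary \<Rightarrow> real \<Rightarrow> 'w \<Rightarrow> 'h \<Rightarrow> 'h" where
  "elementary_process S s \<omega> x =
     (\<Sum>(a, b, B, u, h)\<leftarrow>S. (indicator {a<..b} s * indicator B \<omega> * (u \<bullet> x)) *\<^sub>R h)"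

definition elementary_integral ::
  "(real \<Rightarrow> 'h::real_inner \<Rightarrow> 'w \<Rightarrow> real) \<Rightarrow> ('h, 'w) elementary \<Rightarrow> real \<Rightarrow> 'w \<Rightarrow> 'h" where
  "elementary_integral W S t \<omega> =
     (\<Sum>(a, b, B, u, h)\<leftarrow>S. (indicator B \<omega> * (W (min b t) u \<omega> - W (min a t) u \<omega>)) *\<^sub>R h)"

(* I is the stochastic integral of \<Phi> over [0,t] (determined up to null sets): the L_2(Omega, H)-limit
   of integrals of elementary processes that converge to \<Phi> in the norm given by
   E (integral over [0,t] of the squared Hilbert-Schmidt norm of \<Phi>(s) R), where R = Q^(1/2). *)
definition has_ito_integral ::
  "'w measure \<Rightarrow> (real \<Rightarrow> 'w measure) \<Rightarrow> ('h::{real_inner,banach,second_countable_topology} \<Rightarrow> 'h) \<Rightarrow>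
   (real \<Rightarrow> 'h \<Rightarrow> 'w \<Rightarrow> real) \<Rightarrow> real \<Rightarrow> (real \<Rightarrow> 'w \<Rightarrow> 'h \<Rightarrow> 'h) \<Rightarrow> ('w \<Rightarrow> 'h) \<Rightarrow> bool" where
  "has_ito_integral M F R W t \<Phi> I \<longleftrightarrow>
     I \<in> borel_measurable M \<and>
     (\<forall>x. (\<lambda>(s, \<omega>). \<Phi> s \<omega> x) \<in> borel_measurable (restrict_space lborel {0..t} \<Otimes>\<^sub>M M)) \<and>
     (\<exists>S. (\<forall>n::nat. elementary F (S n)) \<and>
        (\<lambda>n. \<integral>\<^sup>+\<omega>. (\<integral>\<^sup>+s\<in>{0..t}.
            (HS_norm H_norm (\<lambda>x. \<Phi> s \<omega> (R x) - elementary_process (S n) s \<omega> (R x)))\<^sup>2 \<partial>lborel) \<partial>M)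
          \<longlonglongrightarrow> 0 \<and>
        (\<lambda>n. L2_norm M H_norm (\<lambda>\<omega>. I \<omega> - elementary_integral W (S n) t \<omega>)) \<longlonglongrightarrow> 0)"

definition mild_solution ::
  "(nat \<Rightarrow> 'h) \<Rightarrow> (nat \<Rightarrow> real) \<Rightarrow> 'w measure \<Rightarrow> (real \<Rightarrow> 'w measure) \<Rightarrow>
   ('h::{real_inner,banach,second_countable_topology} \<Rightarrow> 'h) \<Rightarrow> (real \<Rightarrow> 'h \<Rightarrow> 'w \<Rightarrow> real) \<Rightarrow>
   ('w \<Rightarrow> 'h) \<Rightarrow> (real \<Rightarrow> 'w \<Rightarrow> 'h) \<Rightarrow> bool" where
  "mild_solution \<phi> lam M F R W X0 X \<longleftrightarrow>
     (\<forall>t\<ge>0. X t \<in> borel_measurable M \<and>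
        (\<exists>I. has_ito_integral M F R W t (\<lambda>s \<omega>. E_semigroup \<phi> lam (t - s)) I \<and>
             (AE \<omega> in M. X t \<omega> = E_semigroup \<phi> lam t (X0 \<omega>) + I \<omega>)))"

end

theory Submission
  imports Defs
begin

text \<open>
  In the eigenbasis of the Neumann Laplacian the equation decouples: the coefficient of the mild
  solution along \<open>\<phi> j\<close> is \<open>exp (- t * (lam j)^2)\<close> times the coefficient of the initial value plus
  the coefficient of the stochastic convolution. The first part is a contraction in every weighted
  norm. For the second part the Ito isometry bounds the second moment by a constant multiple of
  \<open>norm (R (\<phi> j))^2\<close> times the integral over \<open>[0, t]\<close> of \<open>exp (- 2 * (t - s) * (lam j)^2)\<close>.

  This integral is at most \<open>1 / (2 * (lam j)^2)\<close> for a positive eigenvalue, uniformly in \<open>t\<close>. Hence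
  the noise costs two powers of \<open>A\<close>: weighting with \<open>lam j powr \<beta>\<close> and summing over \<open>j\<close> leaves
  \<open>lam j powr (\<beta> - 2) * norm (R (\<phi> j))^2\<close>, and since \<open>R\<close> is symmetric this sum is the squared
  Hilbert--Schmidt norm of \<open>A powr ((\<beta> - 2) / 2)\<close> composed with \<open>R\<close>. On constants nothing decays:
  the integral for the eigenvalue zero is \<open>t\<close>, so that in the norm of \<open>H\<close> there is the further
  contribution \<open>t * norm (R (\<phi> 0))^2\<close>, which produces the square root of \<open>t\<close> and the dependence of the
  constant on the covariance.

  The Ito isometry is needed only for one component at a time, that is for scalar integrals
  (\<open>ito_isometry_elementary\<close>). For elementary integrands it follows from the covariances of products of
  increments (\<open>term_integral_covariance\<close>), and it passes to the limit that defines the stochastic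
  integral (\<open>ito_integral_component_bound\<close>). The modes are put together in
  \<open>mild_solution_weighted_bound\<close>. Squares of sums are throughout estimated by
  \<open>(x + y)^2 \<le> 2 * x^2 + 2 * y^2\<close>, which only affects the constants.
\<close>

section \<open>Extended nonnegative numbers and squares\<close>

lemma esqrt_power2: "(esqrt x)\<^sup>2 = x"
  by (cases x) (auto simp: esqrt_def ennreal_power top_power_ennreal)

lemma esqrt_le_if_le_power2: "esqrt x \<le> y" if "x \<le> y\<^sup>2"
proof (cases y)
  case (real r)
  with that have "x \<le> ennreal (r\<^sup>2)" by (simp add: ennreal_power)
  then obtain q where q: "0 \<le> q" "x = ennreal q" "q \<le> r\<^sup>2"
    by (cases x) (auto simp: top_unique)
  then have "sqrt q \<le> r" using real real_le_lsqrt by auto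
  then show ?thesis using q real by (simp add: esqrt_def)
qed simp

text \<open>
  One of the two sums is read as an integral over the counting measure, so that this is the exchange
  of a series of nonnegative functions with the integral.
\<close>

lemma ennreal_suminf_swap:
  "(\<Sum>i. \<Sum>j. f i j) = (\<Sum>j. \<Sum>i. f i j)" for f :: "nat \<Rightarrow> nat \<Rightarrow> ennreal"
proof -
  have "(\<Sum>i. \<Sum>j. f i j) = (\<integral>\<^sup>+ i. (\<Sum>j. f i j) \<partial>count_space UNIV)"
    by (simp add: nn_integral_count_space_nat)
  also have "\<dots> = (\<Sum>j. \<Sum>i. f i j)"
    by (subst nn_integral_suminf) (simp_all add: nn_integral_count_space_nat)
  finally show ?thesis .
qed

lemma norm_add_power2_le: "(norm (x + y))\<^sup>2 \<le> 2 * (norm x)\<^sup>2 + 2 * (norm y)\<^sup>2"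
  for x y :: "'h::real_inner"
proof -
  have "0 \<le> (x - y) \<bullet> (x - y)" by simp
  then show ?thesis
    unfolding power2_norm_eq_inner
    by (simp add: inner_add_left inner_add_right inner_diff_left inner_diff_right inner_commute)
qed

lemma power2_sum_le: "(x + y)\<^sup>2 \<le> 2 * x\<^sup>2 + 2 * y\<^sup>2" for x y :: real
  using sum_squares_bound[of x y] by (simp add: power2_sum)

section \<open>Orthonormal expansions\<close>

definition fourier_sum :: "(nat \<Rightarrow> 'h::real_inner) \<Rightarrow> nat \<Rightarrow> 'h \<Rightarrow> 'h" where
  "fourier_sum e n v = (\<Sum>j<n. (v \<bullet> e j) *\<^sub>R e j)"

text \<open>
  The Fourier sum of order \<open>n\<close> is the best approximation of \<open>v\<close> from the first \<open>n\<close> basis vectors,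
  and every element of their algebraic span is eventually its own Fourier sum. As the span is dense,
  the Fourier sums converge to \<open>v\<close>, and Pythagoras turns this into convergence of the squares.
\<close>

lemma parseval:
  assumes e: "orthonormal_basis e"
  shows "(\<lambda>j. (v \<bullet> e j)\<^sup>2) sums (norm v)\<^sup>2"
proof -
  have on: "e i \<bullet> e j = (if i = j then 1 else 0)" for i j
    using e by (auto simp: orthonormal_basis_def)
  have coeff: "fourier_sum e n v \<bullet> e j = (if j < n then v \<bullet> e j else 0)" for n j v
    by (simp add: fourier_sum_def inner_sum_left on if_distrib[where f = "\<lambda>x. _ * x"] sum.delta' cong: if_cong)
  have lin: "fourier_sum e n (a *\<^sub>R v + w) = a *\<^sub>R fourier_sum e n v + fourier_sum e n w" for n a v w
    by (simp add: fourier_sum_def inner_add_left scaleR_add_left sum.distrib scaleR_sum_right)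
  have normsq: "(norm (fourier_sum e n v))\<^sup>2 = (\<Sum>j<n. (v \<bullet> e j)\<^sup>2)" for n v
  proof -
    have "(norm (fourier_sum e n v))\<^sup>2 = (\<Sum>j<n. (v \<bullet> e j) * (fourier_sum e n v \<bullet> e j))"
      unfolding power2_norm_eq_inner by (subst (2) fourier_sum_def) (simp add: inner_sum_right)
    then show ?thesis by (simp add: coeff power2_eq_square)
  qed
  have orth: "(v - fourier_sum e n v) \<bullet> fourier_sum e n w = 0" for n v w
    by (subst (2) fourier_sum_def) (simp add: inner_sum_right inner_diff_left coeff)
  have pyth: "(norm (v - fourier_sum e n v))\<^sup>2 = (norm v)\<^sup>2 - (\<Sum>j<n. (v \<bullet> e j)\<^sup>2)" for n v
  proof -
    have "v \<bullet> fourier_sum e n v = fourier_sum e n v \<bullet> fourier_sum e n v"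
      using orth[of v n v] by (simp add: inner_diff_left)
    then show ?thesis
      unfolding normsq[symmetric] power2_norm_eq_inner
      by (simp add: inner_diff_left inner_diff_right inner_commute)
  qed
  have best: "norm (v - fourier_sum e n v) \<le> norm (v - fourier_sum e n w)" for n v w
  proof -
    have eq: "v - fourier_sum e n w = (v - fourier_sum e n v) + fourier_sum e n (v - w)"
      using lin[of n "-1" w v] by simp
    have "(norm (v - fourier_sum e n w))\<^sup>2
        = (norm (v - fourier_sum e n v))\<^sup>2 + (norm (fourier_sum e n (v - w)))\<^sup>2"
      unfolding eq power2_norm_eq_inner
      using orth[of v n "v - w"] by (simp add: inner_add_left inner_add_right inner_commute)
    then show ?thesis by (simp add: norm_le_square flip: power_mono_iff)
       (smt (verit) power2_norm_eq_inner inner_ge_zero)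
  qed
  have span: "\<forall>\<^sub>F n in sequentially. fourier_sum e n w = w" if "w \<in> span (range e)" for w
    using that
  proof (induction rule: span_induct_alt)
    case base
    then show ?case by (simp add: fourier_sum_def)
  next
    case (step c x y)
    then obtain k where k: "x = e k" by auto
    have "\<forall>\<^sub>F n in sequentially. fourier_sum e n x = x"
      using eventually_gt_at_top[of k]
    proof eventually_elim
      case (elim n)
      have "fourier_sum e n x = (\<Sum>j<n. if j = k then e j else 0)"
        unfolding fourier_sum_def k by (intro sum.cong) (auto simp: on)
      with elim k show ?case by simp
    qed
    with step.IH show ?case by eventually_elim (simp add: lin)
  qed
  have "(\<lambda>n. norm (v - fourier_sum e n v)) \<longlonglongrightarrow> 0"
  proof (rule LIMSEQ_I)
    fix r :: real assume "0 < r"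
    moreover have "v \<in> closure (span (range e))" using e by (simp add: orthonormal_basis_def)
    ultimately obtain w where w: "w \<in> span (range e)" "dist w v < r"
      unfolding closure_approachable by blast
    then have "norm (v - w) < r" by (simp add: dist_norm norm_minus_commute)
    with span[OF w(1)] have "\<forall>\<^sub>F n in sequentially. norm (v - fourier_sum e n v) < r"
      by (auto elim!: eventually_mono intro: le_less_trans[OF best[of v _ w]])
    then show "\<exists>no. \<forall>n\<ge>no. norm (norm (v - fourier_sum e n v) - 0) < r"
      by (simp add: eventually_sequentially)
  qed
  then have "(\<lambda>n. (norm v)\<^sup>2 - (norm (v - fourier_sum e n v))\<^sup>2) \<longlonglongrightarrow> (norm v)\<^sup>2 - 0\<^sup>2"
    by (intro tendsto_intros)
  then show ?thesis unfolding sums_def by (simp add: pyth)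
qed

lemma parseval_ennreal:
  "orthonormal_basis e \<Longrightarrow> (\<Sum>j. ennreal ((v \<bullet> e j)\<^sup>2)) = ennreal ((norm v)\<^sup>2)"
  by (intro suminf_ennreal_eq parseval) auto

text \<open>
  The squared norm of a block of the series is the corresponding block of the series of the \<open>(c j)^2\<close>,
  so the series is Cauchy and, by completeness, its value can be paired with \<open>e k\<close> term by term.
\<close>

lemma suminf_orthonormal_inner:
  fixes e :: "nat \<Rightarrow> 'h::{real_inner,banach}"
  assumes on: "\<And>i j. e i \<bullet> e j = (if i = j then 1 else 0)" and c: "summable (\<lambda>j. (c j)\<^sup>2)"
  shows "(\<Sum>j. c j *\<^sub>R e j) \<bullet> e k = c k"
proof -
  have normsq: "(norm (\<Sum>j\<in>{m..<n}. c j *\<^sub>R e j))\<^sup>2 = (\<Sum>j\<in>{m..<n}. (c j)\<^sup>2)" for m n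
    unfolding power2_norm_eq_inner
    by (simp add: inner_sum_left inner_sum_right on power2_eq_square
          if_distrib[where f = "\<lambda>x. _ * x"] sum.delta cong: if_cong)
  have "summable (\<lambda>j. c j *\<^sub>R e j)"
    unfolding summable_Cauchy
  proof (intro allI impI)
    fix r :: real assume "0 < r"
    then obtain N where N: "\<And>m n. m \<ge> N \<Longrightarrow> norm (\<Sum>j\<in>{m..<n}. (c j)\<^sup>2) < r\<^sup>2"
      using c unfolding summable_Cauchy by (meson zero_less_power)
    have "norm (\<Sum>j\<in>{m..<n}. c j *\<^sub>R e j) < r" if "m \<ge> N" for m n
      using N[OF that, of n] \<open>0 < r\<close> unfolding normsq[symmetric]
      by (auto intro: power2_less_imp_less)
    then show "\<exists>N. \<forall>m\<ge>N. \<forall>n. norm (\<Sum>j\<in>{m..<n}. c j *\<^sub>R e j) < r" by blast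
  qed
  then have "(\<Sum>j. c j *\<^sub>R e j) \<bullet> e k = (\<Sum>j. (c j *\<^sub>R e j) \<bullet> e k)"
    by (rule bounded_linear.suminf[OF bounded_linear_inner_left])
  also have "\<dots> = (\<Sum>j. if j = k then c k else 0)"
    by (intro suminf_cong) (auto simp: on)
  also have "\<dots> = c k" by (rule sums_unique[symmetric]) (rule sums_single)
  finally show ?thesis .
qed

lemma E_semigroup_inner:
  assumes e: "orthonormal_basis \<phi>" and "0 \<le> t"
  shows "E_semigroup \<phi> lam t v \<bullet> \<phi> k = exp (- t * (lam k)\<^sup>2) * (v \<bullet> \<phi> k)"
proof -
  have "summable (\<lambda>j. (exp (- t * (lam j)\<^sup>2) * (v \<bullet> \<phi> j))\<^sup>2)"
  proof (rule summable_comparison_test')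
    show "summable (\<lambda>j. (v \<bullet> \<phi> j)\<^sup>2)" using parseval[OF e, of v] by (rule sums_summable)
    have "(exp (- t * (lam j)\<^sup>2))\<^sup>2 \<le> 1" for j using \<open>0 \<le> t\<close> by (simp add: power_le_one)
    then show "norm ((exp (- t * (lam j)\<^sup>2) * (v \<bullet> \<phi> j))\<^sup>2) \<le> (v \<bullet> \<phi> j)\<^sup>2" for j
      by (simp add: power_mult_distrib mult_left_le_one_le)
  qed
  from suminf_orthonormal_inner[OF _ this, of \<phi> k] e show ?thesis
    by (simp add: E_semigroup_def orthonormal_basis_def)
qed

section \<open>Hilbert--Schmidt norms\<close>

text \<open>
  The Hilbert--Schmidt norm is defined through a chosen orthonormal basis; the existence of some
  basis \<open>\<phi>\<close> makes the choice a genuine basis. It is the same basis for every norm \<open>N\<close> and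
  every operator \<open>T\<close>.
\<close>

lemma HS_norm_power2:
  fixes \<phi> :: "nat \<Rightarrow> 'h::real_inner"
  assumes "orthonormal_basis \<phi>"
  obtains e :: "nat \<Rightarrow> 'h" where "orthonormal_basis e" "\<And>N T. (HS_norm N T)\<^sup>2 = (\<Sum>l. (N (T (e l)))\<^sup>2)"
proof
  show "orthonormal_basis (SOME e :: nat \<Rightarrow> 'h. orthonormal_basis e)"
    using someI[of orthonormal_basis, OF assms] .
qed (simp add: HS_norm_def Let_def esqrt_power2)

text \<open>
  Here \<open>w\<close> is the value at \<open>p\<close> of the adjoint of \<open>T\<close>. Its coefficients in the chosen basis are the
  components of the vectors \<open>T (e l)\<close> along \<open>p\<close>, which are dominated by their norms.
\<close>

lemma norm_adjoint_le_HS_norm: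
  fixes \<phi> :: "nat \<Rightarrow> 'h::real_inner" and T :: "'h \<Rightarrow> 'h"
  assumes "orthonormal_basis \<phi>" and "norm p \<le> 1"
    and adj: "\<And>x. T x \<bullet> p = x \<bullet> w"
  shows "ennreal ((norm w)\<^sup>2) \<le> (HS_norm H_norm T)\<^sup>2"
proof -
  obtain e :: "nat \<Rightarrow> 'h" where e: "orthonormal_basis e"
    and HS: "(HS_norm H_norm T)\<^sup>2 = (\<Sum>l. (H_norm (T (e l)))\<^sup>2)"
    using HS_norm_power2[OF assms(1)] by metis
  have "(w \<bullet> e l)\<^sup>2 \<le> (norm (T (e l)))\<^sup>2" for l
  proof -
    have "\<bar>w \<bullet> e l\<bar> \<le> norm (T (e l)) * norm p"
      using Cauchy_Schwarz_ineq2[of "T (e l)" p] adj[of "e l"] by (simp add: inner_commute[of w])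
    also have "\<dots> \<le> norm (T (e l))" using \<open>norm p \<le> 1\<close> by (simp add: mult_left_le)
    finally show ?thesis using power_mono[of "\<bar>w \<bullet> e l\<bar>" _ 2] by simp
  qed
  then have "(\<Sum>l. ennreal ((w \<bullet> e l)\<^sup>2)) \<le> (\<Sum>l. (H_norm (T (e l)))\<^sup>2)"
    by (intro suminf_le) (auto simp: H_norm_def ennreal_power)
  then show ?thesis by (simp add: HS parseval_ennreal[OF e])
qed

text \<open>
  The Hilbert--Schmidt norm does not change under passage to the adjoint: the coefficients of
  \<open>R (e l)\<close> along \<open>\<phi> j\<close> are, by symmetry, those of \<open>R (\<phi> j)\<close> along \<open>e l\<close>, and after the exchange of the
  two sums Parseval removes the chosen basis \<open>e\<close> altogether.
\<close>

lemma HS_Hdot_norm_power2: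
  assumes \<phi>: "orthonormal_basis \<phi>" and sym: "\<And>u v. R u \<bullet> v = u \<bullet> R v"
  shows "(HS_norm (Hdot_norm \<phi> lam s) R)\<^sup>2
      = (\<Sum>j. ennreal (lam (Suc j) powr s) * ennreal ((norm (R (\<phi> (Suc j))))\<^sup>2))"
proof -
  obtain e where e: "orthonormal_basis e"
    and HS: "(HS_norm (Hdot_norm \<phi> lam s) R)\<^sup>2 = (\<Sum>l. (Hdot_norm \<phi> lam s (R (e l)))\<^sup>2)"
    using HS_norm_power2[OF \<phi>] by metis
  have "(HS_norm (Hdot_norm \<phi> lam s) R)\<^sup>2
      = (\<Sum>l. \<Sum>j. ennreal (lam (Suc j) powr s) * ennreal ((R (\<phi> (Suc j)) \<bullet> e l)\<^sup>2))"
    unfolding HS Hdot_norm_def esqrt_power2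
    by (simp add: ennreal_mult sym inner_commute)
  also have "\<dots> = (\<Sum>j. ennreal (lam (Suc j) powr s) * ennreal ((norm (R (\<phi> (Suc j))))\<^sup>2))"
    by (subst ennreal_suminf_swap) (simp add: parseval_ennreal[OF e])
  finally show ?thesis .
qed

section \<open>Energy of a decaying mode\<close>

text \<open>
  The integral of the squared decay factor in the two forms needed later: growth at most linear in
  time, which is sharp for \<open>l = 0\<close>, and a bound uniform in time for \<open>l > 0\<close>, read off from the
  antiderivative.
\<close>

lemma decay_energy:
  assumes "0 \<le> t"
  shows decay_energy_le_time: "(\<integral>\<^sup>+ s\<in>{0..t}. ennreal ((exp (- (t - s) * l\<^sup>2))\<^sup>2) \<partial>lborel) \<le> ennreal t"
    and decay_energy_le_inverse: "0 < l \<Longrightarrow>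
      (\<integral>\<^sup>+ s\<in>{0..t}. ennreal ((exp (- (t - s) * l\<^sup>2))\<^sup>2) \<partial>lborel) \<le> ennreal (1 / (2 * l\<^sup>2))"
proof -
  have "(\<integral>\<^sup>+ s\<in>{0..t}. ennreal ((exp (- (t - s) * l\<^sup>2))\<^sup>2) \<partial>lborel) \<le> (\<integral>\<^sup>+ s. indicator {0..t} s \<partial>lborel)"
    by (intro nn_integral_mono) (auto split: split_indicator simp: mult_nonpos_nonneg intro!: power_le_one)
  also have "\<dots> = ennreal t" using \<open>0 \<le> t\<close> by simp
  finally show "(\<integral>\<^sup>+ s\<in>{0..t}. ennreal ((exp (- (t - s) * l\<^sup>2))\<^sup>2) \<partial>lborel) \<le> ennreal t" .
next
  assume "0 < l"
  define F where "F s = exp (- 2 * (t - s) * l\<^sup>2) / (2 * l\<^sup>2)" for s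
  have sq: "(exp (- (t - s) * l\<^sup>2))\<^sup>2 = exp (- 2 * (t - s) * l\<^sup>2)" for s
    by (simp add: power2_eq_square exp_add[symmetric] algebra_simps)
  have "(\<integral>\<^sup>+ s\<in>{0..t}. ennreal (exp (- 2 * (t - s) * l\<^sup>2)) \<partial>lborel) = ennreal (F t - F 0)"
    by (rule nn_integral_FTC_Icc)
       (use \<open>0 < l\<close> \<open>0 \<le> t\<close> in \<open>auto simp: F_def intro!: derivative_eq_intros\<close>)
  also have "\<dots> \<le> ennreal (1 / (2 * l\<^sup>2))"
    by (intro ennreal_leI) (simp add: F_def)
  finally show "(\<integral>\<^sup>+ s\<in>{0..t}. ennreal ((exp (- (t - s) * l\<^sup>2))\<^sup>2) \<partial>lborel) \<le> ennreal (1 / (2 * l\<^sup>2))"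
    by (simp only: sq)
qed

section \<open>Square-integrable random variables\<close>

text \<open>
  Variance zero is the degenerate law concentrated at the origin, for which there is no density; it
  has to be treated apart because the covariance \<open>Q\<close> may have a kernel.
\<close>

lemma centered_gaussian_moments:
  assumes "prob_space M" and [measurable]: "Y \<in> borel_measurable M"
    and Y: "centered_gaussian M Y v" and "0 \<le> v"
  shows "integrable M Y" "integrable M (\<lambda>\<omega>. (Y \<omega>)\<^sup>2)"
    "(\<integral>\<omega>. Y \<omega> \<partial>M) = 0" "(\<integral>\<omega>. (Y \<omega>)\<^sup>2 \<partial>M) = v"
proof -
  have "integrable M Y \<and> integrable M (\<lambda>\<omega>. (Y \<omega>)\<^sup>2) \<and>
      (\<integral>\<omega>. Y \<omega> \<partial>M) = 0 \<and> (\<integral>\<omega>. (Y \<omega>)\<^sup>2 \<partial>M) = v"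
  proof (cases "v = 0")
    case True
    then have ae: "AE \<omega> in M. Y \<omega> = 0" using Y by (simp add: centered_gaussian_def)
    have "integrable M Y \<longleftrightarrow> integrable M (\<lambda>\<omega>. 0::real)"
      using ae by (intro integrable_cong_AE) auto
    moreover have "integrable M (\<lambda>\<omega>. (Y \<omega>)\<^sup>2) \<longleftrightarrow> integrable M (\<lambda>\<omega>. 0::real)"
      using ae by (intro integrable_cong_AE) auto
    moreover have "(\<integral>\<omega>. Y \<omega> \<partial>M) = 0" by (rule integral_eq_zero_AE[OF ae])
    moreover have "(\<integral>\<omega>. (Y \<omega>)\<^sup>2 \<partial>M) = 0"
      using ae by (intro integral_eq_zero_AE) auto
    ultimately show ?thesis using True by simp
  next
    case False
    then have D: "distributed M lborel Y (\<lambda>x. ennreal (normal_density 0 (sqrt v) x))"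
      using Y by (simp add: centered_gaussian_def)
    have pos: "0 < sqrt v" using False \<open>0 \<le> v\<close> by simp
    interpret prob_space M by fact
    have "integrable M Y"
      using distributed_integrable[OF D, of "\<lambda>x. x"] integrable_normal_moment_nz_1[OF pos, of 0] by simp
    moreover have "integrable M (\<lambda>\<omega>. (Y \<omega>)\<^sup>2)"
      using distributed_integrable[OF D, of "\<lambda>x. x\<^sup>2"] integrable_normal_moment[OF pos, of 0 2] by simp
    moreover have m: "expectation Y = 0"
      using normal_distributed_expectation[OF pos D] .
    moreover have "(\<integral>\<omega>. (Y \<omega>)\<^sup>2 \<partial>M) = v"
      using normal_distributed_variance[OF pos D] m \<open>0 \<le> v\<close> by simp
    ultimately show ?thesis by simp
  qed
  then show "integrable M Y" "integrable M (\<lambda>\<omega>. (Y \<omega>)\<^sup>2)"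
    "(\<integral>\<omega>. Y \<omega> \<partial>M) = 0" "(\<integral>\<omega>. (Y \<omega>)\<^sup>2 \<partial>M) = v" by auto
qed

lemma integrable_mult_of_square_integrable:
  fixes f g :: "'w \<Rightarrow> real"
  assumes [measurable]: "f \<in> borel_measurable M" "g \<in> borel_measurable M"
    and "integrable M (\<lambda>\<omega>. (f \<omega>)\<^sup>2)" "integrable M (\<lambda>\<omega>. (g \<omega>)\<^sup>2)"
  shows "integrable M (\<lambda>\<omega>. f \<omega> * g \<omega>)"
proof (rule Bochner_Integration.integrable_bound)
  show "integrable M (\<lambda>\<omega>. (f \<omega>)\<^sup>2 + (g \<omega>)\<^sup>2)" using assms by simp
  have "\<bar>x * y\<bar> \<le> x\<^sup>2 + y\<^sup>2" for x y :: real
    using sum_squares_bound[of "\<bar>x\<bar>" "\<bar>y\<bar>"] mult_nonneg_nonneg[of "\<bar>x\<bar>" "\<bar>y\<bar>"]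
    by (simp add: abs_mult del: mult_nonneg_nonneg)
  then show "AE \<omega> in M. norm (f \<omega> * g \<omega>) \<le> norm ((f \<omega>)\<^sup>2 + (g \<omega>)\<^sup>2)" by simp
qed simp

section \<open>Increments of a cylindrical Wiener process\<close>

locale cylindrical_wiener = prob_space M
  for M :: "'w measure" +
  fixes F :: "real \<Rightarrow> 'w measure" and Q :: "'h::real_inner \<Rightarrow> 'h"
    and W :: "real \<Rightarrow> 'h \<Rightarrow> 'w \<Rightarrow> real"
  assumes filtered: "filtered_prob_space M F" and covariance: "covariance_operator Q"
    and wiener: "Q_wiener_process M F Q W"
begin

definition increment :: "real \<Rightarrow> real \<Rightarrow> 'h \<Rightarrow> 'w \<Rightarrow> real" where
  "increment a b u \<omega> = W b u \<omega> - W a u \<omega>"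

lemma Q_symmetric: "Q v \<bullet> u = Q u \<bullet> v"
proof -
  have "Q v \<bullet> u = v \<bullet> Q u" using covariance unfolding covariance_operator_def by blast
  then show ?thesis by (simp add: inner_commute)
qed

lemma Q_nonneg: "0 \<le> Q u \<bullet> u"
  using covariance unfolding covariance_operator_def by blast

lemma sets_F_mono: "0 \<le> a \<Longrightarrow> a \<le> b \<Longrightarrow> B \<in> sets (F a) \<Longrightarrow> B \<in> sets (F b)"
  using filtered unfolding filtered_prob_space_def subalgebra_def by blast

lemma sets_F: "0 \<le> a \<Longrightarrow> B \<in> sets (F a) \<Longrightarrow> B \<in> sets M"
  using filtered by (auto simp: filtered_prob_space_def subalgebra_def)

lemma measurable_F: "0 \<le> a \<Longrightarrow> f \<in> borel_measurable (F a) \<Longrightarrow> f \<in> borel_measurable M"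
  using filtered by (auto simp: filtered_prob_space_def intro: measurable_from_subalg)

lemma measurable_F_mono:
  "0 \<le> a \<Longrightarrow> a \<le> b \<Longrightarrow> f \<in> borel_measurable (F a) \<Longrightarrow> f \<in> borel_measurable (F b)"
  using filtered by (auto simp: filtered_prob_space_def intro: measurable_from_subalg)

lemma increment_measurable_F:
  "0 \<le> a \<Longrightarrow> a \<le> b \<Longrightarrow> increment a b u \<in> borel_measurable (F b)"
proof -
  assume ab: "0 \<le> a" "a \<le> b"
  have "W b u \<in> borel_measurable (F b)" "W a u \<in> borel_measurable (F a)"
    using wiener ab by (simp_all add: Q_wiener_process_def)
  then show ?thesis
    unfolding increment_def[abs_def] using measurable_F_mono[OF ab]
    by (intro borel_measurable_diff) auto
qed

lemma increment_measurable:
  "0 \<le> a \<Longrightarrow> a \<le> b \<Longrightarrow> increment a b u \<in> borel_measurable M"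
  using increment_measurable_F[of a b u] measurable_F[of b] by simp

lemma increment_moments:
  assumes "0 \<le> a" "a \<le> b"
  shows "integrable M (increment a b u)" "integrable M (\<lambda>\<omega>. (increment a b u \<omega>)\<^sup>2)"
    "expectation (increment a b u) = 0"
    "expectation (\<lambda>\<omega>. (increment a b u \<omega>)\<^sup>2) = (b - a) * (Q u \<bullet> u)"
proof -
  have g: "centered_gaussian M (increment a b u) ((b - a) * (Q u \<bullet> u))"
  proof (cases "a = b")
    case True
    then show ?thesis by (simp add: centered_gaussian_def increment_def[abs_def])
  next
    case False
    then show ?thesis
      using wiener assms by (simp add: Q_wiener_process_def increment_def[abs_def])
  qed
  have "0 \<le> (b - a) * (Q u \<bullet> u)" using Q_nonneg assms by simp
  note centered_gaussian_moments[OF prob_space_axioms increment_measurable[OF assms] g this]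
  then show "integrable M (increment a b u)" "integrable M (\<lambda>\<omega>. (increment a b u \<omega>)\<^sup>2)"
    "expectation (increment a b u) = 0"
    "expectation (\<lambda>\<omega>. (increment a b u \<omega>)\<^sup>2) = (b - a) * (Q u \<bullet> u)" by auto
qed

text \<open>
  The increment over \<open>(a, b]\<close> is independent of the past up to time \<open>a\<close>, hence so is every function of
  it. The function \<open>g\<close> is later the identity, for the vanishing of mixed moments, or the square, for
  the variances. If \<open>a = b\<close>, the increment is the constant zero.
\<close>

lemma increment_independent:
  fixes g :: "real \<Rightarrow> real"
  assumes ab: "0 \<le> a" "a \<le> b" and X: "X \<in> borel_measurable (F a)" "integrable M X"
    and [measurable]: "g \<in> borel_measurable borel" and g: "integrable M (\<lambda>\<omega>. g (increment a b u \<omega>))"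
  shows "integrable M (\<lambda>\<omega>. X \<omega> * g (increment a b u \<omega>))"
    "expectation (\<lambda>\<omega>. X \<omega> * g (increment a b u \<omega>))
      = expectation X * expectation (\<lambda>\<omega>. g (increment a b u \<omega>))"
proof -
  have iv: "indep_var borel X borel (\<lambda>\<omega>. g (increment a b u \<omega>))" if "a < b"
  proof -
    have ind: "indep_set (sets (F a)) (sets (vimage_algebra (space M) (increment a b u) borel))"
      using wiener ab that by (simp add: Q_wiener_process_def increment_def[abs_def])
    have sp: "space (F a) = space M"
      using filtered ab by (auto simp: filtered_prob_space_def subalgebra_def)
    have "X \<in> borel_measurable M" using X ab measurable_F by auto
    moreover have [measurable]: "increment a b u \<in> borel_measurable M"
      using increment_measurable ab by auto
    moreover have "sigma_sets (space M) {X -` A \<inter> space M |A. A \<in> sets borel} \<subseteq> sets (F a)"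
      using measurable_sets[OF X(1)] sp
      by (intro sets.sigma_sets_subset[of _ "F a", unfolded sp]) auto
    moreover have "sigma_sets (space M) {increment a b u -` A \<inter> space M |A. A \<in> sets borel}
        \<subseteq> sets (vimage_algebra (space M) (increment a b u) borel)"
      by (simp add: sets_vimage_algebra)
    ultimately have "indep_var borel X borel (increment a b u)"
      using ind unfolding indep_var_eq indep_sets2_eq by (meson subset_trans subset_iff)
    from indep_var_compose[OF this, of id borel g borel] show ?thesis
      by (simp add: comp_def)
  qed
  show "integrable M (\<lambda>\<omega>. X \<omega> * g (increment a b u \<omega>))"
    using indep_var_integrable[OF iv X(2) g] X(2) ab by (cases "a = b") (auto simp: increment_def)
  show "expectation (\<lambda>\<omega>. X \<omega> * g (increment a b u \<omega>))
      = expectation X * expectation (\<lambda>\<omega>. g (increment a b u \<omega>))"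
    using indep_var_lebesgue_integral[OF iv X(2) g] ab
    by (cases "a = b") (auto simp: increment_def prob_space)
qed

lemma increment_add:
  assumes "0 \<le> a" "a \<le> b"
  shows "AE \<omega> in M. increment a b (u + v) \<omega> = increment a b u \<omega> + increment a b v \<omega>"
proof -
  have "AE \<omega> in M. W t (u + v) \<omega> = W t u \<omega> + W t v \<omega>" if "0 \<le> t" for t
  proof -
    have "AE \<omega> in M. W t (1 *\<^sub>R u + 1 *\<^sub>R v) \<omega> = 1 * W t u \<omega> + 1 * W t v \<omega>"
      using wiener that unfolding Q_wiener_process_def by blast
    then show ?thesis by simp
  qed
  from this[of a] this[of b] assms show ?thesis
    by (auto simp: increment_def)
qed

text \<open>
  The scalar stochastic integral of the elementary process that equals \<open>u\<close> on the event \<open>B\<close> during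
  \<open>(a, b]\<close>. Elementary integrals are linear combinations of these, so that the isometry comes down to
  their covariances.
\<close>

definition term_integral :: "real \<Rightarrow> real \<Rightarrow> 'w set \<Rightarrow> 'h \<Rightarrow> 'w \<Rightarrow> real" where
  "term_integral a b B u \<omega> = indicator B \<omega> * increment a b u \<omega>"

lemma term_integral_measurable_F:
  assumes "0 \<le> a" "a \<le> b" "B \<in> sets (F a)"
  shows "term_integral a b B u \<in> borel_measurable (F b)"
proof -
  note [measurable] = increment_measurable_F[OF assms(1,2), of u] sets_F_mono[OF assms]
  show ?thesis unfolding term_integral_def[abs_def] by measurable
qed

lemma term_integral_square_integrable:
  assumes "0 \<le> a" "a \<le> b" "B \<in> sets (F a)"
  shows "term_integral a b B u \<in> borel_measurable M"
    "integrable M (\<lambda>\<omega>. (term_integral a b B u \<omega>)\<^sup>2)" "integrable M (term_integral a b B u)"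
proof -
  show [measurable]: "term_integral a b B u \<in> borel_measurable M"
    using term_integral_measurable_F[OF assms] measurable_F[of b] assms by auto
  have le: "\<bar>term_integral a b B u \<omega>\<bar> \<le> \<bar>increment a b u \<omega>\<bar>" for \<omega>
    by (simp add: term_integral_def split: split_indicator)
  show "integrable M (\<lambda>\<omega>. (term_integral a b B u \<omega>)\<^sup>2)"
    by (rule Bochner_Integration.integrable_bound[OF increment_moments(2)[OF assms(1,2), of u]])
       (use le in \<open>auto simp: abs_le_square_iff\<close>)
  show "integrable M (term_integral a b B u)"
    by (rule Bochner_Integration.integrable_bound[OF increment_moments(1)[OF assms(1,2), of u]])
       (use le in auto)
qed

lemma term_integral_mult_integrable:
  assumes "0 \<le> a" "a \<le> b" "B \<in> sets (F a)" "0 \<le> c" "c \<le> d" "C \<in> sets (F c)"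
  shows "integrable M (\<lambda>\<omega>. term_integral a b B u \<omega> * term_integral c d C v \<omega>)"
  using assms by (intro integrable_mult_of_square_integrable term_integral_square_integrable)

lemma term_integral_split:
  "term_integral a b B u \<omega> = term_integral a m B u \<omega> + term_integral m b B u \<omega>"
  by (simp add: term_integral_def increment_def algebra_simps)

text \<open>
  Everything except the later increment is known at time \<open>c\<close>, and that increment is independent of the
  past with mean zero.
\<close>

lemma term_integral_disjoint:
  assumes "0 \<le> a" "a \<le> b" "B \<in> sets (F a)" "b \<le> c" "c \<le> d" "C \<in> sets (F c)"
  shows "expectation (\<lambda>\<omega>. term_integral a b B u \<omega> * term_integral c d C v \<omega>) = 0"
proof -
  let ?X = "\<lambda>\<omega>. term_integral a b B u \<omega> * indicator C \<omega>"
  have "0 \<le> b" "0 \<le> c" using assms by auto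
  have CM: "C \<in> sets M" using sets_F assms \<open>0 \<le> c\<close> by blast
  have "?X \<in> borel_measurable (F c)"
    using measurable_F_mono[OF \<open>0 \<le> b\<close> \<open>b \<le> c\<close> term_integral_measurable_F[OF assms(1-3), of u]] assms(6)
    by measurable
  moreover have "integrable M ?X"
  proof (rule Bochner_Integration.integrable_bound[OF term_integral_square_integrable(3)[OF assms(1-3), of u]])
    note [measurable] = CM term_integral_square_integrable(1)[OF assms(1-3), of u]
    show "?X \<in> borel_measurable M" by measurable
  qed (auto split: split_indicator)
  ultimately have "expectation (\<lambda>\<omega>. ?X \<omega> * increment c d v \<omega>) = 0"
    using increment_independent(2)[OF \<open>0 \<le> c\<close> \<open>c \<le> d\<close>, of ?X "\<lambda>x. x" v]
      increment_moments[OF \<open>0 \<le> c\<close> \<open>c \<le> d\<close>] by simp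
  then show ?thesis by (simp add: term_integral_def mult.assoc)
qed

text \<open>
  The law of the process gives only the variance of the increments in each single direction.
  Polarisation yields the covariances, since the increment in the direction \<open>u + v\<close> is almost surely
  the sum of those in the directions \<open>u\<close> and \<open>v\<close>.
\<close>

lemma increment_covariance:
  assumes "0 \<le> a" "a \<le> b" "B \<in> sets (F a)"
  shows "expectation (\<lambda>\<omega>. indicator B \<omega> * (increment a b u \<omega> * increment a b v \<omega>))
    = prob B * ((b - a) * (Q u \<bullet> v))"
proof -
  let ?D = "increment a b"
  have BM: "B \<in> sets M" using sets_F assms by blast
  have X: "indicator B \<in> borel_measurable (F a)" "integrable M (indicator B :: 'w \<Rightarrow> real)"
    using assms BM by (auto simp: emeasure_eq_measure)
  note sq = increment_independent[OF assms(1,2) X, of "\<lambda>x. x\<^sup>2"]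
  have sq_int: "integrable M (\<lambda>\<omega>. indicator B \<omega> * (?D w \<omega>)\<^sup>2)"
    and sq_exp: "expectation (\<lambda>\<omega>. indicator B \<omega> * (?D w \<omega>)\<^sup>2) = prob B * ((b - a) * (Q w \<bullet> w))" for w
    using sq[of w] increment_moments[OF assms(1,2), of w] BM by (auto simp: measure_def[symmetric])
  have meas: "?D w \<in> borel_measurable M" for w using increment_measurable assms by blast
  note [measurable] = BM meas
  have "AE \<omega> in M. indicator B \<omega> * (?D u \<omega> * ?D v \<omega>)
      = (indicator B \<omega> * (?D (u + v) \<omega>)\<^sup>2 - indicator B \<omega> * (?D u \<omega>)\<^sup>2 - indicator B \<omega> * (?D v \<omega>)\<^sup>2) / 2"
    using increment_add[OF assms(1,2), of u v]
    by eventually_elim (simp add: power2_sum algebra_simps)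
  then have "expectation (\<lambda>\<omega>. indicator B \<omega> * (?D u \<omega> * ?D v \<omega>))
      = expectation (\<lambda>\<omega>. (indicator B \<omega> * (?D (u + v) \<omega>)\<^sup>2 - indicator B \<omega> * (?D u \<omega>)\<^sup>2
          - indicator B \<omega> * (?D v \<omega>)\<^sup>2) / 2)"
    by (intro integral_cong_AE) auto
  also have "\<dots> = prob B * ((b - a) * ((Q (u + v) \<bullet> (u + v) - Q u \<bullet> u - Q v \<bullet> v) / 2))"
    by (simp add: sq_int sq_exp algebra_simps)
  also have "(Q (u + v) \<bullet> (u + v) - Q u \<bullet> u - Q v \<bullet> v) / 2 = Q u \<bullet> v"
  proof -
    have "Q (u + v) = Q u + Q v"
      using covariance unfolding covariance_operator_def by (simp add: linear_simps)
    then show ?thesis by (simp add: inner_add_left inner_add_right Q_symmetric[of v u])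
  qed
  finally show ?thesis .
qed

text \<open>
  Splitting the longer interval at the end of the shorter one leaves the same increment interval
  twice; the rest is uncorrelated.
\<close>

lemma term_integral_common_start:
  assumes a: "0 \<le> a" and "a \<le> b" "b \<le> d" "B \<in> sets (F a)" "C \<in> sets (F a)"
  shows "expectation (\<lambda>\<omega>. term_integral a b B u \<omega> * term_integral a d C v \<omega>)
    = prob (B \<inter> C) * ((b - a) * (Q u \<bullet> v))"
proof -
  have Cb: "C \<in> sets (F b)" using sets_F_mono assms by blast
  have "expectation (\<lambda>\<omega>. term_integral a b B u \<omega> * term_integral a d C v \<omega>)
      = expectation (\<lambda>\<omega>. term_integral a b B u \<omega> * term_integral a b C v \<omega>
          + term_integral a b B u \<omega> * term_integral b d C v \<omega>)"
    by (subst term_integral_split[of a d C v _ b]) (simp add: distrib_left)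
  also have "\<dots> = expectation (\<lambda>\<omega>. term_integral a b B u \<omega> * term_integral a b C v \<omega>)"
    using term_integral_disjoint[of a b B b d C u v] assms Cb
    by (subst Bochner_Integration.integral_add) (auto intro!: term_integral_mult_integrable)
  also have "\<dots> = expectation (\<lambda>\<omega>. indicator (B \<inter> C) \<omega> * (increment a b u \<omega> * increment a b v \<omega>))"
    by (simp add: term_integral_def indicator_inter_arith mult_ac)
  also have "\<dots> = prob (B \<inter> C) * ((b - a) * (Q u \<bullet> v))"
    using assms by (intro increment_covariance) auto
  finally show ?thesis .
qed

text \<open>
  Splitting the earlier interval at the start \<open>c\<close> of the later one reduces overlapping intervals to
  intervals with a common start.
\<close>

lemma term_integral_covariance_ordered:
  assumes "0 \<le> a" "a \<le> b" "B \<in> sets (F a)" "a \<le> c" "c \<le> d" "C \<in> sets (F c)"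
  shows "expectation (\<lambda>\<omega>. term_integral a b B u \<omega> * term_integral c d C v \<omega>)
    = prob (B \<inter> C) * (max 0 (min b d - c) * (Q u \<bullet> v))"
proof (cases "b \<le> c")
  case True
  with assms show ?thesis by (simp add: term_integral_disjoint)
next
  case False
  have Bc: "B \<in> sets (F c)" by (rule sets_F_mono[OF assms(1,4,3)])
  have "0 \<le> c" using assms by linarith
  have "expectation (\<lambda>\<omega>. term_integral a b B u \<omega> * term_integral c d C v \<omega>)
      = expectation (\<lambda>\<omega>. term_integral a c B u \<omega> * term_integral c d C v \<omega>
          + term_integral c b B u \<omega> * term_integral c d C v \<omega>)"
    by (subst term_integral_split[of a b B u _ c]) (simp add: distrib_right)
  also have "\<dots> = expectation (\<lambda>\<omega>. term_integral c b B u \<omega> * term_integral c d C v \<omega>)"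
    using term_integral_disjoint[of a c B c d C u v] assms Bc False
    by (subst Bochner_Integration.integral_add) (auto intro!: term_integral_mult_integrable)
  also have "\<dots> = prob (B \<inter> C) * (max 0 (min b d - c) * (Q u \<bullet> v))"
  proof (cases "b \<le> d")
    case True
    then show ?thesis using term_integral_common_start[of c b d B C u v] False Bc assms \<open>0 \<le> c\<close> by simp
  next
    case False
    then show ?thesis
      using term_integral_common_start[of c d b C B v u] False Bc assms \<open>0 \<le> c\<close>
      by (simp add: mult.commute[of "term_integral c d C v _"] Int_commute Q_symmetric[of v u])
  qed
  finally show ?thesis .
qed

text \<open>
  Here both integrals are stopped at \<open>t\<close>. If an interval begins after \<open>t\<close>, its integral is zero, in
  accordance with the right-hand side, where the length of the overlap is then truncated to zero.
\<close>

lemma term_integral_covariance: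
  assumes "0 \<le> a" "a \<le> b" "B \<in> sets (F a)" "0 \<le> c" "c \<le> d" "C \<in> sets (F c)" "0 \<le> t"
  shows "expectation (\<lambda>\<omega>. term_integral (min a t) (min b t) B u \<omega> * term_integral (min c t) (min d t) C v \<omega>)
    = prob (B \<inter> C) * (max 0 (min (min b d) t - max a c) * (Q u \<bullet> v))"
proof -
  consider "t < a" | "t < c" | "a \<le> t" "c \<le> t" "a \<le> c" | "a \<le> t" "c \<le> t" "c \<le> a" by linarith
  then show ?thesis
  proof cases
    case 1
    with assms show ?thesis by (simp add: term_integral_def increment_def)
  next
    case 2
    with assms show ?thesis by (simp add: term_integral_def increment_def)
  next
    case 3
    with assms show ?thesis
      using term_integral_covariance_ordered[of a "min b t" B c "min d t" C u v]
      by (simp add: min.commute min.left_commute max_def)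
  next
    case 4
    with assms show ?thesis
      using term_integral_covariance_ordered[of c "min d t" C a "min b t" B v u]
      by (simp add: mult.commute[of "term_integral c _ C v _"] Int_commute Q_symmetric[of v u]
            min.commute min.left_commute max_def)
  qed
qed

lemma truncated_term_integral_square_integrable:
  assumes "0 \<le> a" "a \<le> b" "B \<in> sets (F a)" "0 \<le> t"
  shows "term_integral (min a t) (min b t) B u \<in> borel_measurable M"
    "integrable M (\<lambda>\<omega>. (term_integral (min a t) (min b t) B u \<omega>)\<^sup>2)"
proof -
  have "term_integral (min a t) (min b t) B u \<in> borel_measurable M \<and>
    integrable M (\<lambda>\<omega>. (term_integral (min a t) (min b t) B u \<omega>)\<^sup>2)"
  proof (cases "a \<le> t")
    case True
    then show ?thesis using term_integral_square_integrable[of a "min b t" B u] assms by simp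
  next
    case False
    then have "term_integral (min a t) (min b t) B u = (\<lambda>\<omega>. 0)"
      using assms by (simp add: term_integral_def increment_def fun_eq_iff)
    then show ?thesis by simp
  qed
  then show "term_integral (min a t) (min b t) B u \<in> borel_measurable M"
    "integrable M (\<lambda>\<omega>. (term_integral (min a t) (min b t) B u \<omega>)\<^sup>2)" by auto
qed

end

section \<open>The Ito isometry for elementary integrands\<close>

lemma overlap_indicator:
  fixes a b c d t s :: real
  assumes "0 \<le> a" 
  shows "indicator {a<..b} s * indicator {c<..d} s * indicator {0..t} s
    = (indicator {max a c<..min (min b d) t} s :: real)"
  using assms by (auto split: split_indicator)

text \<open>
  The value at \<open>p\<close> of the adjoint of the elementary process. The component of the stochastic integral
  along \<open>p\<close> is the scalar stochastic integral of this process.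
\<close>

definition elementary_adjoint :: "('h::real_inner, 'w) elementary \<Rightarrow> 'h \<Rightarrow> real \<Rightarrow> 'w \<Rightarrow> 'h" where
  "elementary_adjoint S p s \<omega> =
     (\<Sum>(a, b, B, u, h)\<leftarrow>S. (indicator {a<..b} s * indicator B \<omega> * (h \<bullet> p)) *\<^sub>R u)"

lemma elementary_process_inner:
  "elementary_process S s \<omega> x \<bullet> p = x \<bullet> elementary_adjoint S p s \<omega>"
  unfolding elementary_process_def elementary_adjoint_def
  by (induction S) (auto simp: inner_add_left inner_add_right inner_commute)

context cylindrical_wiener begin

text \<open>
  Both sides expand into the same double sum \<open>G\<close> over pairs of terms: on the left by the covariances
  of the terms, on the right because a product of two interval indicators integrates to the length of
  the overlap.
\<close>

lemma ito_isometry_finite_sum: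
  fixes a b c :: "'i \<Rightarrow> real" and B :: "'i \<Rightarrow> 'w set" and u :: "'i \<Rightarrow> 'h"
  assumes I: "finite I" and t: "0 \<le> t"
    and ab: "\<And>i. i \<in> I \<Longrightarrow> 0 \<le> a i \<and> a i \<le> b i \<and> B i \<in> sets (F (a i))"
  defines "v \<equiv> \<lambda>s \<omega>. \<Sum>i\<in>I. (indicator {a i<..b i} s * indicator (B i) \<omega> * c i) *\<^sub>R u i"
  shows "(\<integral>\<^sup>+\<omega>. ennreal ((\<Sum>i\<in>I. c i * term_integral (min (a i) t) (min (b i) t) (B i) (u i) \<omega>)\<^sup>2) \<partial>M)
    = (\<integral>\<^sup>+\<omega>. (\<integral>\<^sup>+s\<in>{0..t}. ennreal (Q (v s \<omega>) \<bullet> v s \<omega>) \<partial>lborel) \<partial>M)"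
proof -
  let ?Z = "\<lambda>i. term_integral (min (a i) t) (min (b i) t) (B i) (u i)"
  let ?J = "\<lambda>i k. {max (a i) (a k)<..min (min (b i) (b k)) t}"
  let ?len = "\<lambda>i k. max 0 (min (min (b i) (b k)) t - max (a i) (a k))"
  let ?q = "\<lambda>i k \<omega>. c i * c k * (Q (u i) \<bullet> u k) * indicator (B i \<inter> B k) \<omega>"
  define G where "G = (\<Sum>i\<in>I. \<Sum>k\<in>I. c i * c k * (prob (B i \<inter> B k) * (?len i k * (Q (u i) \<bullet> u k))))"
  have BM [measurable]: "i \<in> I \<Longrightarrow> B i \<in> sets M" for i
    using ab sets_F by blast
  have Zm [measurable]: "i \<in> I \<Longrightarrow> ?Z i \<in> borel_measurable M"
    and Z2: "i \<in> I \<Longrightarrow> integrable M (\<lambda>\<omega>. (?Z i \<omega>)\<^sup>2)" for i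
    using truncated_term_integral_square_integrable[of "a i" "b i" "B i" t "u i"] ab t by auto
  have ZZ: "i \<in> I \<Longrightarrow> k \<in> I \<Longrightarrow> integrable M (\<lambda>\<omega>. ?Z i \<omega> * ?Z k \<omega>)" for i k
    by (intro integrable_mult_of_square_integrable Zm Z2)
  have expand: "(\<Sum>i\<in>I. c i * ?Z i \<omega>)\<^sup>2 = (\<Sum>i\<in>I. \<Sum>k\<in>I. c i * c k * (?Z i \<omega> * ?Z k \<omega>))" for \<omega>
    unfolding power2_eq_square sum_product by (simp add: mult_ac)
  have int: "integrable M (\<lambda>\<omega>. \<Sum>i\<in>I. \<Sum>k\<in>I. c i * c k * (?Z i \<omega> * ?Z k \<omega>))"
    by (intro Bochner_Integration.integrable_sum integrable_mult_right ZZ)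
  have "(\<integral>\<^sup>+\<omega>. ennreal ((\<Sum>i\<in>I. c i * ?Z i \<omega>)\<^sup>2) \<partial>M)
      = ennreal (expectation (\<lambda>\<omega>. (\<Sum>i\<in>I. c i * ?Z i \<omega>)\<^sup>2))"
    by (rule nn_integral_eq_integral) (use int in \<open>simp_all add: expand[symmetric]\<close>)
  also have "expectation (\<lambda>\<omega>. (\<Sum>i\<in>I. c i * ?Z i \<omega>)\<^sup>2) = G"
    unfolding expand G_def
    using ab t by (simp add: Bochner_Integration.integral_sum ZZ term_integral_covariance)
  finally have lhs: "(\<integral>\<^sup>+\<omega>. ennreal ((\<Sum>i\<in>I. c i * ?Z i \<omega>)\<^sup>2) \<partial>M) = ennreal G" .

  have lin: "bounded_linear Q" using covariance by (simp add: covariance_operator_def)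
  have inner: "(\<integral>\<^sup>+s\<in>{0..t}. ennreal (Q (v s \<omega>) \<bullet> v s \<omega>) \<partial>lborel)
      = ennreal (\<Sum>i\<in>I. \<Sum>k\<in>I. ?q i k \<omega> * ?len i k)"
    and nonneg: "0 \<le> (\<Sum>i\<in>I. \<Sum>k\<in>I. ?q i k \<omega> * ?len i k)" for \<omega>
  proof -
    have "Q (v s \<omega>) = (\<Sum>i\<in>I. (indicator {a i<..b i} s * indicator (B i) \<omega> * c i) *\<^sub>R Q (u i))" for s
      unfolding v_def using lin by (simp add: linear_sum[OF bounded_linear.linear] bounded_linear.linear
          linear_cmul[OF bounded_linear.linear])
    then have "Q (v s \<omega>) \<bullet> v s \<omega> = (\<Sum>i\<in>I. \<Sum>k\<in>I. ?q i k \<omega> * (indicator {a i<..b i} s * indicator {a k<..b k} s))" for s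
      by (simp add: v_def inner_sum_left inner_sum_right sum_distrib_left indicator_inter_arith mult_ac Q_symmetric)
    then have q: "Q (v s \<omega>) \<bullet> v s \<omega> * indicator {0..t} s = (\<Sum>i\<in>I. \<Sum>k\<in>I. ?q i k \<omega> * indicator (?J i k) s)" for s
      using ab by (auto simp: sum_distrib_right mult.assoc overlap_indicator[simplified mult.assoc] intro!: sum.cong)
    have "(LINT s|lborel. indicator {x<..y} s) = max 0 (y - x)"
      and "integrable lborel (indicator {x<..y} :: real \<Rightarrow> real)" for x y :: real
      by (cases "x \<le> y"; simp)+
    note meas = this
    have integ: "integrable lborel (\<lambda>s. Q (v s \<omega>) \<bullet> v s \<omega> * indicator {0..t} s)"
      unfolding q by (intro Bochner_Integration.integrable_sum integrable_mult_right meas)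
    have eq: "(LINT s|lborel. Q (v s \<omega>) \<bullet> v s \<omega> * indicator {0..t} s) = (\<Sum>i\<in>I. \<Sum>k\<in>I. ?q i k \<omega> * ?len i k)"
      unfolding q using meas by (simp add: Bochner_Integration.integral_sum)
    have pos: "0 \<le> Q (v s \<omega>) \<bullet> v s \<omega> * indicator {0..t} s" for s
      by (simp add: Q_nonneg)
    show "0 \<le> (\<Sum>i\<in>I. \<Sum>k\<in>I. ?q i k \<omega> * ?len i k)"
      unfolding eq[symmetric] by (intro integral_nonneg_AE) (simp add: pos)
    have "(\<integral>\<^sup>+s\<in>{0..t}. ennreal (Q (v s \<omega>) \<bullet> v s \<omega>) \<partial>lborel)
        = (\<integral>\<^sup>+s. ennreal (Q (v s \<omega>) \<bullet> v s \<omega> * indicator {0..t} s) \<partial>lborel)"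
      by (intro nn_integral_cong) (auto split: split_indicator)
    also have "\<dots> = ennreal (\<Sum>i\<in>I. \<Sum>k\<in>I. ?q i k \<omega> * ?len i k)"
      unfolding eq[symmetric] using integ pos by (intro nn_integral_eq_integral) auto
    finally show "(\<integral>\<^sup>+s\<in>{0..t}. ennreal (Q (v s \<omega>) \<bullet> v s \<omega>) \<partial>lborel)
      = ennreal (\<Sum>i\<in>I. \<Sum>k\<in>I. ?q i k \<omega> * ?len i k)" .
  qed
  have ind: "i \<in> I \<Longrightarrow> k \<in> I \<Longrightarrow> integrable M (indicator (B i \<inter> B k) :: 'w \<Rightarrow> real)" for i k
    using BM by (auto simp: emeasure_eq_measure)
  have int': "integrable M (\<lambda>\<omega>. \<Sum>i\<in>I. \<Sum>k\<in>I. ?q i k \<omega> * ?len i k)"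
    by (intro Bochner_Integration.integrable_sum integrable_mult_right integrable_mult_left ind)
  have "(\<integral>\<^sup>+\<omega>. (\<integral>\<^sup>+s\<in>{0..t}. ennreal (Q (v s \<omega>) \<bullet> v s \<omega>) \<partial>lborel) \<partial>M)
      = ennreal (expectation (\<lambda>\<omega>. \<Sum>i\<in>I. \<Sum>k\<in>I. ?q i k \<omega> * ?len i k))"
    unfolding inner by (rule nn_integral_eq_integral[OF int']) (simp add: nonneg)
  also have "expectation (\<lambda>\<omega>. \<Sum>i\<in>I. \<Sum>k\<in>I. ?q i k \<omega> * ?len i k)
      = (\<Sum>i\<in>I. \<Sum>k\<in>I. c i * c k * (Q (u i) \<bullet> u k) * prob (B i \<inter> B k) * ?len i k)"
  proof -
    have "expectation (\<lambda>\<omega>. ?q i k \<omega> * ?len i k) = c i * c k * (Q (u i) \<bullet> u k) * prob (B i \<inter> B k) * ?len i k"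
      if "i \<in> I" "k \<in> I" for i k
      using ind[OF that] BM that by simp
    moreover have "integrable M (\<lambda>\<omega>. ?q i k \<omega> * ?len i k)" if "i \<in> I" "k \<in> I" for i k
      by (intro integrable_mult_right integrable_mult_left ind that)
    ultimately show ?thesis
      by (simp add: Bochner_Integration.integral_sum cong: sum.cong)
  qed
  also have "\<dots> = G" unfolding G_def by (simp add: mult_ac)
  finally show ?thesis using lhs by simp
qed

lemma ito_isometry_elementary:
  assumes S: "elementary F S" and t: "0 \<le> t"
  shows "(\<integral>\<^sup>+\<omega>. ennreal ((elementary_integral W S t \<omega> \<bullet> p)\<^sup>2) \<partial>M)
    = (\<integral>\<^sup>+\<omega>. (\<integral>\<^sup>+s\<in>{0..t}. ennreal (Q (elementary_adjoint S p s \<omega>) \<bullet> elementary_adjoint S p s \<omega>) \<partial>lborel) \<partial>M)"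
proof -
  define I where "I = {0..<length S}"
  define a b B u c where "a i = fst (S ! i)" and "b i = fst (snd (S ! i))"
    and "B i = fst (snd (snd (S ! i)))" and "u i = fst (snd (snd (snd (S ! i))))"
    and "c i = snd (snd (snd (snd (S ! i)))) \<bullet> p" for i
  have "0 \<le> a i \<and> a i \<le> b i \<and> B i \<in> sets (F (a i))" if "i \<in> I" for i
    using S that unfolding elementary_def a_def b_def B_def I_def
    by (fastforce simp: in_set_conv_nth split_beta)
  note iso = ito_isometry_finite_sum[of I t a b B c u, OF _ t this]
  have "elementary_integral W S t \<omega> \<bullet> p
      = (\<Sum>i\<in>I. c i * term_integral (min (a i) t) (min (b i) t) (B i) (u i) \<omega>)" for \<omega>
  proof -
    have "elementary_integral W S t \<omega> \<bullet> p
      = (\<Sum>x\<leftarrow>S. (snd (snd (snd (snd x))) \<bullet> p) *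
          term_integral (min (fst x) t) (min (fst (snd x)) t) (fst (snd (snd x))) (fst (snd (snd (snd x)))) \<omega>)"
      unfolding elementary_integral_def term_integral_def increment_def
      by (induction S) (auto simp: inner_add_left mult_ac)
    then show ?thesis
      by (simp add: sum_list_sum_nth I_def a_def b_def B_def u_def c_def)
  qed
  moreover have "elementary_adjoint S p s \<omega>
      = (\<Sum>i\<in>I. (indicator {a i<..b i} s * indicator (B i) \<omega> * c i) *\<^sub>R u i)" for s \<omega>
    unfolding elementary_adjoint_def
    by (simp add: sum_list_sum_nth I_def a_def b_def B_def u_def c_def split_beta)
  ultimately show ?thesis using iso by (simp add: I_def)
qed

end

section \<open>Components of the stochastic integral\<close>

lemma elementary_integral_measurable:
  fixes Q :: "'h::{real_inner,second_countable_topology} \<Rightarrow> 'h"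
  assumes "cylindrical_wiener M F Q W" and "elementary F S" and "0 \<le> t"
  shows "elementary_integral W S t \<in> borel_measurable M"
proof -
  interpret cylindrical_wiener M F Q W by fact
  have W: "W r u \<in> borel_measurable M" if "0 \<le> r" for r u
    using wiener that by (intro measurable_F[OF that]) (simp add: Q_wiener_process_def)
  show ?thesis
    using \<open>elementary F S\<close> unfolding elementary_integral_def[abs_def]
  proof (induction S)
    case (Cons x S)
    obtain a b B u h where x: "x = (a, b, B, u, h)" by (cases x)
    have ab: "0 \<le> a" "a \<le> b" "B \<in> sets (F a)" "elementary F S"
      using Cons.prems by (auto simp: elementary_def x)
    have [measurable]: "W (min a t) u \<in> borel_measurable M" "W (min b t) u \<in> borel_measurable M"
      using ab(1,2) \<open>0 \<le> t\<close> by (auto intro: W)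
    note [measurable] = sets_F[OF ab(1,3)] Cons.IH[OF ab(4)]
    have "(\<lambda>\<omega>. (indicator B \<omega> * (W (min b t) u \<omega> - W (min a t) u \<omega>)) *\<^sub>R h +
        (\<Sum>(a, b, B, u, h)\<leftarrow>S. (indicator B \<omega> * (W (min b t) u \<omega> - W (min a t) u \<omega>)) *\<^sub>R h))
        \<in> borel_measurable M"
      by measurable
    then show ?case by (simp add: x)
  qed simp
qed

lemma elementary_adjoint_measurable:
  fixes Q :: "'h::{real_inner,second_countable_topology} \<Rightarrow> 'h" and S :: "('h, 'w) elementary"
  assumes "cylindrical_wiener M F Q W" and "elementary F S"
  shows "(\<lambda>(\<omega>, s). elementary_adjoint S p s \<omega>) \<in> borel_measurable (M \<Otimes>\<^sub>M lborel)"
proof -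
  interpret cylindrical_wiener M F Q W by fact
  show ?thesis
    using \<open>elementary F S\<close> unfolding elementary_adjoint_def[abs_def]
  proof (induction S)
    case (Cons x S)
    obtain a b B u h where x: "x = (a, b, B, u, h)" by (cases x)
    have ab: "0 \<le> a" "B \<in> sets (F a)" "elementary F S"
      using Cons.prems by (auto simp: elementary_def x)
    have [measurable]: "(\<lambda>x. indicator {a<..b} (snd x) :: real) \<in> borel_measurable (M \<Otimes>\<^sub>M lborel)"
      by (rule measurable_compose[OF measurable_snd]) simp
    have [measurable]: "(\<lambda>x. indicator B (fst x) :: real) \<in> borel_measurable (M \<Otimes>\<^sub>M lborel)"
      by (rule measurable_compose[OF measurable_fst borel_measurable_indicator[OF sets_F[OF ab(1,2)]]])
    have "(\<lambda>x. (indicator {a<..b} (snd x) * indicator B (fst x) * (h \<bullet> p)) *\<^sub>R u)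
        \<in> borel_measurable (M \<Otimes>\<^sub>M lborel)"
      by measurable
    from borel_measurable_add[OF this Cons.IH[OF ab(3)]] show ?case
      by (simp add: x split_beta')
  qed simp
qed

text \<open>
  The component along \<open>p\<close> of an integral of a deterministic integrand \<open>T\<close>, with \<open>g s\<close> the value at \<open>p\<close> of
  the adjoint of \<open>T s\<close>. The approximating elementary integrals satisfy the isometry exactly. Two
  parallelogram estimates, one for the integrals and one for the integrands, compare them with \<open>I\<close>
  and \<open>g\<close>; each costs a factor two and an error that vanishes in the limit, since the error of the
  integrands along \<open>p\<close> is controlled by the Hilbert--Schmidt norm.
\<close>

lemma ito_integral_component_bound:
  fixes Q R :: "'h::{real_inner,banach,second_countable_topology} \<Rightarrow> 'h"
  assumes W: "cylindrical_wiener M F Q W" and R: "operator_sqrt R Q"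
    and basis: "orthonormal_basis (\<phi> :: nat \<Rightarrow> 'h)" and p: "norm p \<le> 1" and t: "0 \<le> t"
    and ito: "has_ito_integral M F R W t (\<lambda>s \<omega>. T s) I"
    and adj: "\<And>s x. s \<in> {0..t} \<Longrightarrow> T s x \<bullet> p = x \<bullet> g s"
    and g [measurable]: "g \<in> borel_measurable borel"
  shows "(\<integral>\<^sup>+\<omega>. ennreal ((I \<omega> \<bullet> p)\<^sup>2) \<partial>M) \<le> 4 * (\<integral>\<^sup>+s\<in>{0..t}. ennreal ((norm (R (g s)))\<^sup>2) \<partial>lborel)"
proof -
  interpret cylindrical_wiener M F Q W by fact
  obtain S where S: "\<And>n::nat. elementary F (S n)"
    and lim1: "(\<lambda>n. \<integral>\<^sup>+\<omega>. (\<integral>\<^sup>+s\<in>{0..t}.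
            (HS_norm H_norm (\<lambda>x. T s (R x) - elementary_process (S n) s \<omega> (R x)))\<^sup>2 \<partial>lborel) \<partial>M)
          \<longlonglongrightarrow> 0" (is "?\<epsilon> \<longlonglongrightarrow> 0")
    and lim2: "(\<lambda>n. L2_norm M H_norm (\<lambda>\<omega>. I \<omega> - elementary_integral W (S n) t \<omega>)) \<longlonglongrightarrow> 0"
      (is "?\<eta> \<longlonglongrightarrow> 0")
    and I [measurable]: "I \<in> borel_measurable M"
    using ito unfolding has_ito_integral_def by auto
  have lin: "bounded_linear R" and symR: "R u \<bullet> v = u \<bullet> R v" and RR: "R (R u) = Q u" for u v
    using R by (auto simp: operator_sqrt_def covariance_operator_def)
  have [measurable]: "R \<in> borel_measurable borel"
    using lin by (intro borel_measurable_continuous_onI linear_continuous_on)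
  let ?G = "\<integral>\<^sup>+s\<in>{0..t}. ennreal ((norm (R (g s)))\<^sup>2) \<partial>lborel"
  let ?v = "\<lambda>n. elementary_adjoint (S n) p"
  have bound: "(\<integral>\<^sup>+\<omega>. ennreal ((I \<omega> \<bullet> p)\<^sup>2) \<partial>M) \<le> 4 * ?G + (4 * ?\<epsilon> n + 2 * (?\<eta> n)\<^sup>2)" for n
  proof -
    let ?Y = "elementary_integral W (S n) t"
    have [measurable]: "?Y \<in> borel_measurable M"
      by (rule elementary_integral_measurable[OF W S t])
    note [measurable] = elementary_adjoint_measurable[OF W S, of n p]
    have [measurable]: "(\<lambda>s. ?v n s \<omega>) \<in> borel_measurable lborel" if "\<omega> \<in> space M" for \<omega>
      using measurable_compose[OF measurable_Pair1'[OF that] elementary_adjoint_measurable[OF W S, of n p]]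
      by simp
    have "(\<integral>\<^sup>+\<omega>. ennreal ((I \<omega> \<bullet> p)\<^sup>2) \<partial>M)
        \<le> (\<integral>\<^sup>+\<omega>. 2 * ennreal ((?Y \<omega> \<bullet> p)\<^sup>2) + 2 * (H_norm (I \<omega> - ?Y \<omega>))\<^sup>2 \<partial>M)"
    proof (rule nn_integral_mono)
      fix \<omega>
      have "\<bar>(I \<omega> - ?Y \<omega>) \<bullet> p\<bar> \<le> norm (I \<omega> - ?Y \<omega>)"
        using Cauchy_Schwarz_ineq2[of "I \<omega> - ?Y \<omega>" p] mult_left_le[OF p, of "norm (I \<omega> - ?Y \<omega>)"] by simp
      then have "((I \<omega> - ?Y \<omega>) \<bullet> p)\<^sup>2 \<le> (norm (I \<omega> - ?Y \<omega>))\<^sup>2"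
        using power_mono[of "\<bar>(I \<omega> - ?Y \<omega>) \<bullet> p\<bar>" _ 2] by simp
      then have "(I \<omega> \<bullet> p)\<^sup>2 \<le> 2 * (?Y \<omega> \<bullet> p)\<^sup>2 + 2 * (norm (I \<omega> - ?Y \<omega>))\<^sup>2"
        using power2_sum_le[of "?Y \<omega> \<bullet> p" "(I \<omega> - ?Y \<omega>) \<bullet> p"] by (simp add: inner_diff_left)
      then have "ennreal ((I \<omega> \<bullet> p)\<^sup>2) \<le> ennreal (2 * (?Y \<omega> \<bullet> p)\<^sup>2 + 2 * (norm (I \<omega> - ?Y \<omega>))\<^sup>2)"
        by (rule ennreal_leI)
      then show "ennreal ((I \<omega> \<bullet> p)\<^sup>2) \<le> 2 * ennreal ((?Y \<omega> \<bullet> p)\<^sup>2) + 2 * (H_norm (I \<omega> - ?Y \<omega>))\<^sup>2"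
        by (simp add: H_norm_def ennreal_power ennreal_plus ennreal_mult)
    qed
    also have "\<dots> = 2 * (\<integral>\<^sup>+\<omega>. ennreal ((?Y \<omega> \<bullet> p)\<^sup>2) \<partial>M) + 2 * (?\<eta> n)\<^sup>2"
      by (simp add: L2_norm_def esqrt_power2 H_norm_def nn_integral_add nn_integral_cmult)
    finally have I_le: "(\<integral>\<^sup>+\<omega>. ennreal ((I \<omega> \<bullet> p)\<^sup>2) \<partial>M)
        \<le> 2 * (\<integral>\<^sup>+\<omega>. ennreal ((?Y \<omega> \<bullet> p)\<^sup>2) \<partial>M) + 2 * (?\<eta> n)\<^sup>2" .
    have "(\<integral>\<^sup>+\<omega>. ennreal ((?Y \<omega> \<bullet> p)\<^sup>2) \<partial>M)
        = (\<integral>\<^sup>+\<omega>. (\<integral>\<^sup>+s\<in>{0..t}. ennreal ((norm (R (?v n s \<omega>)))\<^sup>2) \<partial>lborel) \<partial>M)"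
      unfolding ito_isometry_elementary[OF S t] by (simp add: power2_norm_eq_inner symR RR inner_commute)
    also have "\<dots> \<le> (\<integral>\<^sup>+\<omega>. (\<integral>\<^sup>+s. 2 * (ennreal ((norm (R (g s)))\<^sup>2) * indicator {0..t} s)
        + 2 * (ennreal ((norm (R (g s) - R (?v n s \<omega>)))\<^sup>2) * indicator {0..t} s) \<partial>lborel) \<partial>M)"
    proof (intro nn_integral_mono)
      fix \<omega> s
      have "(norm (R (?v n s \<omega>)))\<^sup>2 \<le> 2 * (norm (R (g s)))\<^sup>2 + 2 * (norm (R (g s) - R (?v n s \<omega>)))\<^sup>2"
        using norm_add_power2_le[of "R (g s)" "R (?v n s \<omega>) - R (g s)"] by (simp add: norm_minus_commute)
      then have "ennreal ((norm (R (?v n s \<omega>)))\<^sup>2) \<le> ennreal (2 * (norm (R (g s)))\<^sup>2 + 2 * (norm (R (g s) - R (?v n s \<omega>)))\<^sup>2)"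
        by (rule ennreal_leI)
      then show "ennreal ((norm (R (?v n s \<omega>)))\<^sup>2) * indicator {0..t} s
        \<le> 2 * (ennreal ((norm (R (g s)))\<^sup>2) * indicator {0..t} s)
        + 2 * (ennreal ((norm (R (g s) - R (?v n s \<omega>)))\<^sup>2) * indicator {0..t} s)"
        by (auto simp: ennreal_plus ennreal_mult split: split_indicator)
    qed
    also have "\<dots> = (\<integral>\<^sup>+\<omega>. 2 * ?G + 2 * (\<integral>\<^sup>+s\<in>{0..t}. ennreal ((norm (R (g s) - R (?v n s \<omega>)))\<^sup>2) \<partial>lborel) \<partial>M)"
      by (intro nn_integral_cong) (simp add: nn_integral_add nn_integral_cmult)
    also have "\<dots> = 2 * ?G + 2 * (\<integral>\<^sup>+\<omega>. (\<integral>\<^sup>+s\<in>{0..t}. ennreal ((norm (R (g s) - R (?v n s \<omega>)))\<^sup>2) \<partial>lborel) \<partial>M)"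
      by (simp add: nn_integral_add nn_integral_cmult emeasure_space_1)
    also have "\<dots> \<le> 2 * ?G + 2 * ?\<epsilon> n"
    proof (intro add_left_mono mult_left_mono nn_integral_mono)
      fix \<omega> s
      have "ennreal ((norm (R (g s) - R (?v n s \<omega>)))\<^sup>2)
          \<le> (HS_norm H_norm (\<lambda>x. T s (R x) - elementary_process (S n) s \<omega> (R x)))\<^sup>2" if "s \<in> {0..t}"
      proof (rule norm_adjoint_le_HS_norm[OF basis p])
        show "(T s (R x) - elementary_process (S n) s \<omega> (R x)) \<bullet> p = x \<bullet> (R (g s) - R (?v n s \<omega>))" for x
          by (simp add: inner_diff_left inner_diff_right adj[OF that] elementary_process_inner symR)
      qed
      then show "ennreal ((norm (R (g s) - R (?v n s \<omega>)))\<^sup>2) * indicator {0..t} s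
          \<le> (HS_norm H_norm (\<lambda>x. T s (R x) - elementary_process (S n) s \<omega> (R x)))\<^sup>2 * indicator {0..t} s"
        by (auto split: split_indicator)
    qed simp
    finally have Y_le: "(\<integral>\<^sup>+\<omega>. ennreal ((?Y \<omega> \<bullet> p)\<^sup>2) \<partial>M) \<le> 2 * ?G + 2 * ?\<epsilon> n" .
    note I_le
    also have "2 * (\<integral>\<^sup>+\<omega>. ennreal ((?Y \<omega> \<bullet> p)\<^sup>2) \<partial>M) + 2 * (?\<eta> n)\<^sup>2
        \<le> 2 * (2 * ?G + 2 * ?\<epsilon> n) + 2 * (?\<eta> n)\<^sup>2"
      by (intro add_right_mono mult_left_mono Y_le) simp
    also have "2 * (2 * ?G + 2 * ?\<epsilon> n) + 2 * (?\<eta> n)\<^sup>2 = 4 * ?G + (4 * ?\<epsilon> n + 2 * (?\<eta> n)\<^sup>2)"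
      by (simp add: distrib_left mult.assoc[symmetric] add.assoc)
    finally show ?thesis .
  qed
  have "(\<lambda>n. (?\<eta> n)\<^sup>2) \<longlonglongrightarrow> 0 * 0"
    unfolding power2_eq_square by (intro tendsto_mult_ennreal lim2) auto
  then have "(\<lambda>n. 4 * ?G + (4 * ?\<epsilon> n + 2 * (?\<eta> n)\<^sup>2)) \<longlonglongrightarrow> 4 * ?G + (4 * 0 + 2 * 0)"
    by (intro tendsto_add tendsto_const ennreal_tendsto_cmult lim1) auto
  then have "(\<lambda>n. 4 * ?G + (4 * ?\<epsilon> n + 2 * (?\<eta> n)\<^sup>2)) \<longlonglongrightarrow> 4 * ?G" by simp
  then show ?thesis
    by (rule LIMSEQ_le_const) (use bound in blast)
qed

section \<open>Stability of the mild solution\<close>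

text \<open>
  The index map \<open>k\<close> selects the modes and \<open>wt\<close> weights them: the seminorms of \<open>Hdot_norm\<close> skip the
  constant mode and use powers of the eigenvalues, the norm of \<open>H\<close> uses all modes with weight one.
  The modes are estimated one by one, and then the expectation is exchanged with the series.
\<close>

lemma mild_solution_weighted_bound:
  fixes Q R :: "'h::{real_inner,banach,second_countable_topology} \<Rightarrow> 'h"
    and \<phi> :: "nat \<Rightarrow> 'h" and wt :: "nat \<Rightarrow> ennreal" and k :: "nat \<Rightarrow> nat"
  assumes W: "cylindrical_wiener M F Q W" and R: "operator_sqrt R Q"
    and basis: "orthonormal_basis \<phi>" and t: "0 \<le> t"
    and X0 [measurable]: "X0 \<in> borel_measurable M"
    and mild: "mild_solution \<phi> lam M F R W X0 X"
  shows "(\<integral>\<^sup>+\<omega>. (\<Sum>j. wt j * ennreal ((X t \<omega> \<bullet> \<phi> (k j))\<^sup>2)) \<partial>M)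
    \<le> 2 * (\<integral>\<^sup>+\<omega>. (\<Sum>j. wt j * ennreal ((X0 \<omega> \<bullet> \<phi> (k j))\<^sup>2)) \<partial>M)
      + 8 * (\<Sum>j. wt j * (ennreal ((norm (R (\<phi> (k j))))\<^sup>2) *
          (\<integral>\<^sup>+s\<in>{0..t}. ennreal ((exp (- (t - s) * (lam (k j))\<^sup>2))\<^sup>2) \<partial>lborel)))"
proof -
  let ?E = "E_semigroup \<phi> lam"
  let ?\<kappa> = "\<lambda>i. \<integral>\<^sup>+s\<in>{0..t}. ennreal ((exp (- (t - s) * (lam i)\<^sup>2))\<^sup>2) \<partial>lborel"
  obtain I where Xm [measurable]: "X t \<in> borel_measurable M"
    and ito: "has_ito_integral M F R W t (\<lambda>s \<omega>. ?E (t - s)) I"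
    and X: "AE \<omega> in M. X t \<omega> = ?E t (X0 \<omega>) + I \<omega>"
    using mild t unfolding mild_solution_def by blast
  have I [measurable]: "I \<in> borel_measurable M" using ito unfolding has_ito_integral_def by blast
  have norm\<phi>: "norm (\<phi> i) \<le> 1" for i
    using basis by (simp add: orthonormal_basis_def norm_eq_sqrt_inner)
  have linR: "linear R" using R by (simp add: operator_sqrt_def covariance_operator_def bounded_linear.linear)
  have noise: "(\<integral>\<^sup>+\<omega>. ennreal ((I \<omega> \<bullet> \<phi> i)\<^sup>2) \<partial>M) \<le> 4 * (ennreal ((norm (R (\<phi> i)))\<^sup>2) * ?\<kappa> i)" for i
  proof -
    let ?g = "\<lambda>s. exp (- (t - s) * (lam i)\<^sup>2) *\<^sub>R \<phi> i"
    have "(\<integral>\<^sup>+\<omega>. ennreal ((I \<omega> \<bullet> \<phi> i)\<^sup>2) \<partial>M)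
        \<le> 4 * (\<integral>\<^sup>+s\<in>{0..t}. ennreal ((norm (R (?g s)))\<^sup>2) \<partial>lborel)"
    proof (rule ito_integral_component_bound[OF W R basis norm\<phi> t ito])
      show "?E (t - s) x \<bullet> \<phi> i = x \<bullet> ?g s" if "s \<in> {0..t}" for s x
        using that by (simp add: E_semigroup_inner[OF basis])
    qed measurable
    also have "(\<integral>\<^sup>+s\<in>{0..t}. ennreal ((norm (R (?g s)))\<^sup>2) \<partial>lborel)
        = (\<integral>\<^sup>+s. ennreal ((norm (R (\<phi> i)))\<^sup>2) * (ennreal ((exp (- (t - s) * (lam i)\<^sup>2))\<^sup>2) * indicator {0..t} s) \<partial>lborel)"
      by (intro nn_integral_cong)
        (simp add: linear_cmul[OF linR] power_mult_distrib ennreal_mult mult_ac)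
    also have "\<dots> = ennreal ((norm (R (\<phi> i)))\<^sup>2) * ?\<kappa> i"
      by (rule nn_integral_cmult) measurable
    finally show ?thesis .
  qed
  have comp: "(\<integral>\<^sup>+\<omega>. ennreal ((X t \<omega> \<bullet> \<phi> i)\<^sup>2) \<partial>M)
      \<le> 2 * (\<integral>\<^sup>+\<omega>. ennreal ((X0 \<omega> \<bullet> \<phi> i)\<^sup>2) \<partial>M) + 8 * (ennreal ((norm (R (\<phi> i)))\<^sup>2) * ?\<kappa> i)" for i
  proof -
    have "AE \<omega> in M. ennreal ((X t \<omega> \<bullet> \<phi> i)\<^sup>2)
        \<le> 2 * ennreal ((X0 \<omega> \<bullet> \<phi> i)\<^sup>2) + 2 * ennreal ((I \<omega> \<bullet> \<phi> i)\<^sup>2)"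
      using X
    proof eventually_elim
      case (elim \<omega>)
      let ?e = "exp (- t * (lam i)\<^sup>2)"
      have "?e\<^sup>2 \<le> 1" using t by (simp add: power_le_one)
      then have "(?e * (X0 \<omega> \<bullet> \<phi> i))\<^sup>2 \<le> (X0 \<omega> \<bullet> \<phi> i)\<^sup>2"
        by (simp add: power_mult_distrib mult_left_le_one_le)
      moreover have "X t \<omega> \<bullet> \<phi> i = ?e * (X0 \<omega> \<bullet> \<phi> i) + I \<omega> \<bullet> \<phi> i"
        by (simp add: elim inner_add_left E_semigroup_inner[OF basis t])
      ultimately have "(X t \<omega> \<bullet> \<phi> i)\<^sup>2 \<le> 2 * (X0 \<omega> \<bullet> \<phi> i)\<^sup>2 + 2 * (I \<omega> \<bullet> \<phi> i)\<^sup>2"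
        using power2_sum_le[of "?e * (X0 \<omega> \<bullet> \<phi> i)" "I \<omega> \<bullet> \<phi> i"] by simp
      then have "ennreal ((X t \<omega> \<bullet> \<phi> i)\<^sup>2) \<le> ennreal (2 * (X0 \<omega> \<bullet> \<phi> i)\<^sup>2 + 2 * (I \<omega> \<bullet> \<phi> i)\<^sup>2)"
        by (rule ennreal_leI)
      then show ?case by (simp add: ennreal_plus ennreal_mult)
    qed
    then have "(\<integral>\<^sup>+\<omega>. ennreal ((X t \<omega> \<bullet> \<phi> i)\<^sup>2) \<partial>M)
        \<le> (\<integral>\<^sup>+\<omega>. 2 * ennreal ((X0 \<omega> \<bullet> \<phi> i)\<^sup>2) + 2 * ennreal ((I \<omega> \<bullet> \<phi> i)\<^sup>2) \<partial>M)"
      by (rule nn_integral_mono_AE)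
    also have "\<dots> = 2 * (\<integral>\<^sup>+\<omega>. ennreal ((X0 \<omega> \<bullet> \<phi> i)\<^sup>2) \<partial>M) + 2 * (\<integral>\<^sup>+\<omega>. ennreal ((I \<omega> \<bullet> \<phi> i)\<^sup>2) \<partial>M)"
      by (simp add: nn_integral_add nn_integral_cmult)
    also have "\<dots> \<le> 2 * (\<integral>\<^sup>+\<omega>. ennreal ((X0 \<omega> \<bullet> \<phi> i)\<^sup>2) \<partial>M)
        + 2 * (4 * (ennreal ((norm (R (\<phi> i)))\<^sup>2) * ?\<kappa> i))"
      by (intro add_left_mono mult_left_mono noise) simp
    finally show ?thesis by (simp add: mult.assoc[symmetric])
  qed
  have "(\<integral>\<^sup>+\<omega>. (\<Sum>j. wt j * ennreal ((X t \<omega> \<bullet> \<phi> (k j))\<^sup>2)) \<partial>M)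
      = (\<Sum>j. wt j * (\<integral>\<^sup>+\<omega>. ennreal ((X t \<omega> \<bullet> \<phi> (k j))\<^sup>2) \<partial>M))"
    by (simp add: nn_integral_suminf nn_integral_cmult)
  also have "\<dots> \<le> (\<Sum>j. wt j * (2 * (\<integral>\<^sup>+\<omega>. ennreal ((X0 \<omega> \<bullet> \<phi> (k j))\<^sup>2) \<partial>M)
      + 8 * (ennreal ((norm (R (\<phi> (k j))))\<^sup>2) * ?\<kappa> (k j))))"
    by (intro suminf_le mult_left_mono comp) auto
  also have "\<dots> = (\<Sum>j. 2 * (wt j * (\<integral>\<^sup>+\<omega>. ennreal ((X0 \<omega> \<bullet> \<phi> (k j))\<^sup>2) \<partial>M))
      + 8 * (wt j * (ennreal ((norm (R (\<phi> (k j))))\<^sup>2) * ?\<kappa> (k j))))"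
    by (simp add: distrib_left mult_ac)
  also have "\<dots> = 2 * (\<Sum>j. wt j * (\<integral>\<^sup>+\<omega>. ennreal ((X0 \<omega> \<bullet> \<phi> (k j))\<^sup>2) \<partial>M))
      + 8 * (\<Sum>j. wt j * (ennreal ((norm (R (\<phi> (k j))))\<^sup>2) * ?\<kappa> (k j)))"
    by (simp add: suminf_add[symmetric])
  also have "(\<Sum>j. wt j * (\<integral>\<^sup>+\<omega>. ennreal ((X0 \<omega> \<bullet> \<phi> (k j))\<^sup>2) \<partial>M))
      = (\<integral>\<^sup>+\<omega>. (\<Sum>j. wt j * ennreal ((X0 \<omega> \<bullet> \<phi> (k j))\<^sup>2)) \<partial>M)"
    by (simp add: nn_integral_suminf nn_integral_cmult)
  finally show ?thesis .
qed

lemma cylindrical_wienerI: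
  "filtered_prob_space M F \<Longrightarrow> covariance_operator Q \<Longrightarrow> Q_wiener_process M F Q W
    \<Longrightarrow> cylindrical_wiener M F Q W"
  by (simp add: cylindrical_wiener_def cylindrical_wiener_axioms_def filtered_prob_space_def)

lemma L2_norm_le_if_power2_le: "L2_norm M N X \<le> y" if "(L2_norm M N X)\<^sup>2 \<le> y\<^sup>2"
  using that esqrt_le_if_le_power2 by (simp add: L2_norm_def esqrt_power2)

lemma neumann_eigenvalue_pos:
  assumes "neumann_eigenbasis D cls \<phi> lam"
  shows "0 < lam (Suc j)"
proof (induction j)
  case (Suc j)
  have "lam (Suc j) \<le> lam (Suc (Suc j))" using assms by (auto simp: neumann_eigenbasis_def)
  with Suc show ?case by simp
qed (use assms in \<open>simp add: neumann_eigenbasis_def\<close>)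

text \<open>
  The gain of two powers of \<open>A\<close> from the smoothing of the semigroup, mode by mode: the
  energy bound \<open>1 / (2 * l^2)\<close> lowers the exponent of \<open>l\<close> by two and cancels the factor 2.
\<close>

lemma powr_noise_energy_le:
  assumes "0 < l" and "0 \<le> t"
  shows "2 * (ennreal (l powr \<beta>) * (ennreal r * (\<integral>\<^sup>+s\<in>{0..t}. ennreal ((exp (- (t - s) * l\<^sup>2))\<^sup>2) \<partial>lborel)))
    \<le> ennreal (l powr (\<beta> - 2)) * ennreal r"
proof -
  have "2 * (ennreal (l powr \<beta>) * (ennreal r * (\<integral>\<^sup>+s\<in>{0..t}. ennreal ((exp (- (t - s) * l\<^sup>2))\<^sup>2) \<partial>lborel)))
      \<le> 2 * (ennreal (l powr \<beta>) * (ennreal r * ennreal (1 / (2 * l\<^sup>2))))"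
    by (intro mult_left_mono decay_energy_le_inverse assms) auto
  also have "\<dots> = (ennreal 2 * ennreal (l powr \<beta>) * ennreal (1 / (2 * l\<^sup>2))) * ennreal r"
    by (simp add: mult_ac)
  also have "ennreal 2 * ennreal (l powr \<beta>) * ennreal (1 / (2 * l\<^sup>2)) = ennreal (2 * l powr \<beta> * (1 / (2 * l\<^sup>2)))"
    by (simp only: ennreal_mult mult_nonneg_nonneg powr_ge_zero zero_le_power2 zero_le_divide_1_iff zero_le_numeral)
  also have "2 * l powr \<beta> * (1 / (2 * l\<^sup>2)) = l powr (\<beta> - 2)"
    using \<open>0 < l\<close> by (simp add: powr_diff powr_numeral)
  finally show ?thesis .
qed

text \<open>
  The seminorm sees only modes with positive eigenvalue, and each of them gains two powers of \<open>A\<close>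
  uniformly in time; therefore the constant depends neither on \<open>t\<close> nor on the covariance.
\<close>

lemma Hdot_stability:
  fixes Q R :: "'h::{real_inner,banach,second_countable_topology} \<Rightarrow> 'h"
  assumes W: "cylindrical_wiener M F Q W" and R: "operator_sqrt R Q"
    and eigen: "neumann_eigenbasis D cls \<phi> lam" and t: "0 \<le> t"
    and X0: "X0 \<in> borel_measurable M" and mild: "mild_solution \<phi> lam M F R W X0 X"
  shows "L2_norm M (Hdot_norm \<phi> lam \<beta>) (X t)
    \<le> ennreal 2 * (L2_norm M (Hdot_norm \<phi> lam \<beta>) X0 + HS_norm (Hdot_norm \<phi> lam (\<beta> - 2)) R)"
proof -
  have basis: "orthonormal_basis \<phi>" using eigen by (simp add: neumann_eigenbasis_def)
  have symR: "R u \<bullet> v = u \<bullet> R v" for u v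
    using R by (simp add: operator_sqrt_def covariance_operator_def)
  let ?A = "L2_norm M (Hdot_norm \<phi> lam \<beta>) X0" and ?K = "HS_norm (Hdot_norm \<phi> lam (\<beta> - 2)) R"
  have L2: "(L2_norm M (Hdot_norm \<phi> lam \<beta>) Y)\<^sup>2
      = (\<integral>\<^sup>+\<omega>. (\<Sum>j. ennreal (lam (Suc j) powr \<beta>) * ennreal ((Y \<omega> \<bullet> \<phi> (Suc j))\<^sup>2)) \<partial>M)" for Y
    by (simp add: L2_norm_def Hdot_norm_def esqrt_power2 ennreal_mult)
  have "(L2_norm M (Hdot_norm \<phi> lam \<beta>) (X t))\<^sup>2 \<le> 2 * ?A\<^sup>2
      + 8 * (\<Sum>j. ennreal (lam (Suc j) powr \<beta>) * (ennreal ((norm (R (\<phi> (Suc j))))\<^sup>2) *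
          (\<integral>\<^sup>+s\<in>{0..t}. ennreal ((exp (- (t - s) * (lam (Suc j))\<^sup>2))\<^sup>2) \<partial>lborel)))"
    unfolding L2 by (rule mild_solution_weighted_bound[OF W R basis t X0 mild])
  also have "\<dots> = 2 * ?A\<^sup>2 + 4 * (\<Sum>j. 2 * (ennreal (lam (Suc j) powr \<beta>) * (ennreal ((norm (R (\<phi> (Suc j))))\<^sup>2) *
          (\<integral>\<^sup>+s\<in>{0..t}. ennreal ((exp (- (t - s) * (lam (Suc j))\<^sup>2))\<^sup>2) \<partial>lborel))))"
    unfolding ennreal_suminf_cmult by (simp add: mult.assoc[symmetric])
  also have "\<dots> \<le> 2 * ?A\<^sup>2 + 4 * ?K\<^sup>2"
    unfolding HS_Hdot_norm_power2[OF basis symR]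
    by (intro add_left_mono mult_left_mono suminf_le powr_noise_energy_le
        neumann_eigenvalue_pos[OF eigen] t) auto
  also have "2 * ?A\<^sup>2 + 4 * ?K\<^sup>2 \<le> 4 * ?A\<^sup>2 + 4 * ?K\<^sup>2 + 8 * (?A * ?K)"
    by (rule add_increasing2, simp, intro add_right_mono mult_right_mono, simp_all)
  also have "\<dots> = (ennreal 2 * (?A + ?K))\<^sup>2"
    proof -
    have sq: "(?A + ?K)\<^sup>2 = ?A\<^sup>2 + ?K\<^sup>2 + 2 * (?A * ?K)"
      by (simp add: power2_sum mult.assoc)
    show ?thesis
      unfolding power_mult_distrib sq by (simp add: distrib_left mult.assoc[symmetric])
  qed
  finally show ?thesis by (rule L2_norm_le_if_power2_le)
qed

text \<open>
  The modes with positive eigenvalue are treated as for the seminorm with exponent zero, so they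
  contribute uniformly in time. Along \<open>\<phi> 0\<close> the stochastic convolution does not decay and its variance
  \<open>t * norm (R (\<phi> 0))^2\<close> is the source of the last summand and of the dependence of the constant on \<open>R\<close>.
\<close>

lemma H_stability:
  fixes Q R :: "'h::{real_inner,banach,second_countable_topology} \<Rightarrow> 'h"
  assumes W: "cylindrical_wiener M F Q W" and R: "operator_sqrt R Q"
    and eigen: "neumann_eigenbasis D cls \<phi> lam" and t: "0 \<le> t"
    and X0: "X0 \<in> borel_measurable M" and mild: "mild_solution \<phi> lam M F R W X0 X"
  shows "L2_norm M H_norm (X t) \<le> ennreal (sqrt (4 + 8 * (norm (R (\<phi> 0)))\<^sup>2)) *
    (L2_norm M H_norm X0 + HS_norm (Hdot_norm \<phi> lam (-2)) R + ennreal (sqrt t))"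
proof -
  have basis: "orthonormal_basis \<phi>" using eigen by (simp add: neumann_eigenbasis_def)
  have symR: "R u \<bullet> v = u \<bullet> R v" for u v
    using R by (simp add: operator_sqrt_def covariance_operator_def)
  let ?A = "L2_norm M H_norm X0" and ?K = "HS_norm (Hdot_norm \<phi> lam (-2)) R" and ?T = "ennreal (sqrt t)"
  let ?n = "\<lambda>j. ennreal ((norm (R (\<phi> j)))\<^sup>2)"
  let ?\<kappa> = "\<lambda>i. \<integral>\<^sup>+s\<in>{0..t}. ennreal ((exp (- (t - s) * (lam i)\<^sup>2))\<^sup>2) \<partial>lborel"
  have L2: "(L2_norm M H_norm Y)\<^sup>2 = (\<integral>\<^sup>+\<omega>. (\<Sum>j. 1 * ennreal ((Y \<omega> \<bullet> \<phi> j)\<^sup>2)) \<partial>M)" for Y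
    by (simp add: L2_norm_def H_norm_def esqrt_power2 ennreal_power parseval_ennreal[OF basis])
  have T2: "?T\<^sup>2 = ennreal t" using t by (simp add: ennreal_power)
  have tail: "2 * (?n (Suc j) * ?\<kappa> (Suc j)) \<le> ennreal (lam (Suc j) powr (-2)) * ?n (Suc j)" for j
    using powr_noise_energy_le[OF neumann_eigenvalue_pos[OF eigen, of j] t, of 0 "(norm (R (\<phi> (Suc j))))\<^sup>2"]
      neumann_eigenvalue_pos[OF eigen, of j] by simp
  have "2 * (\<Sum>j. ?n j * ?\<kappa> j) = 2 * ((\<Sum>j. ?n (Suc j) * ?\<kappa> (Suc j)) + ?n 0 * ?\<kappa> 0)"
    by (intro arg_cong[where f = "(*) 2"] sums_unique[symmetric] sums_Suc[where f = "\<lambda>j. ?n j * ?\<kappa> j"]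
        summable_sums summableI)
  also have "\<dots> = (\<Sum>j. 2 * (?n (Suc j) * ?\<kappa> (Suc j))) + 2 * (?n 0 * ?\<kappa> 0)"
    by (simp add: distrib_left)
  also have "\<dots> \<le> ?K\<^sup>2 + 2 * (?n 0 * ?T\<^sup>2)"
    unfolding T2 HS_Hdot_norm_power2[OF basis symR]
    by (intro add_mono suminf_le tail mult_left_mono decay_energy_le_time t) auto
  finally have noise: "2 * (\<Sum>j. ?n j * ?\<kappa> j) \<le> ?K\<^sup>2 + 2 * (?n 0 * ?T\<^sup>2)" .
  have "(L2_norm M H_norm (X t))\<^sup>2 \<le> 2 * ?A\<^sup>2 + 8 * (\<Sum>j. 1 * (?n j * ?\<kappa> j))"
    unfolding L2 by (rule mild_solution_weighted_bound[OF W R basis t X0 mild])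
  also have "\<dots> = 2 * ?A\<^sup>2 + 4 * (2 * (\<Sum>j. ?n j * ?\<kappa> j))"
    by (simp add: mult.assoc[symmetric])
  also have "\<dots> \<le> 2 * ?A\<^sup>2 + 4 * (?K\<^sup>2 + 2 * (?n 0 * ?T\<^sup>2))"
    by (intro add_left_mono mult_left_mono noise) simp
  also have "\<dots> = 2 * ?A\<^sup>2 + 4 * ?K\<^sup>2 + 8 * ?n 0 * ?T\<^sup>2"
    by (simp add: distrib_left mult.assoc[symmetric] add.assoc)
  also have "\<dots> \<le> (4 + 8 * ?n 0) * (?A\<^sup>2 + ?K\<^sup>2 + ?T\<^sup>2)"
  proof -
    have "2 * ?A\<^sup>2 \<le> (4 + 8 * ?n 0) * ?A\<^sup>2" "4 * ?K\<^sup>2 \<le> (4 + 8 * ?n 0) * ?K\<^sup>2"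
      by (intro mult_right_mono add_increasing2; simp)+
    moreover have "8 * ?n 0 * ?T\<^sup>2 \<le> (4 + 8 * ?n 0) * ?T\<^sup>2"
      by (intro mult_right_mono add_increasing; simp)
    ultimately show ?thesis unfolding distrib_left by (intro add_mono)
  qed
  also have "\<dots> \<le> (4 + 8 * ?n 0) * (?A + ?K + ?T)\<^sup>2"
  proof (rule mult_left_mono)
    have "(?A + ?K + ?T)\<^sup>2 = (?A\<^sup>2 + ?K\<^sup>2 + ?T\<^sup>2) + 2 * (?A * ?K + ?A * ?T + ?K * ?T)"
      by (simp add: power2_eq_square algebra_simps mult_2)
    then show "?A\<^sup>2 + ?K\<^sup>2 + ?T\<^sup>2 \<le> (?A + ?K + ?T)\<^sup>2" by simp
  qed simp
  also have "4 + 8 * ?n 0 = (ennreal (sqrt (4 + 8 * (norm (R (\<phi> 0)))\<^sup>2)))\<^sup>2"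
    by (simp add: ennreal_power ennreal_plus ennreal_mult)
  finally show ?thesis
    by (intro L2_norm_le_if_power2_le) (simp add: power_mult_distrib)
qed

theorem theorem3p1:
  fixes D :: "'a::euclidean_space set"
    and cls :: "('a \<Rightarrow> real) \<Rightarrow> 'h::{real_inner,banach,second_countable_topology}"
    and \<phi> :: "nat \<Rightarrow> 'h" and lam :: "nat \<Rightarrow> real"
  assumes "DIM('a) \<le> 3" and "smooth_bounded_domain D" and "L2_space D cls"
    and "neumann_eigenbasis D cls \<phi> lam"
  shows
    "(\<forall>\<beta>\<ge>0. \<exists>C::real.
        \<forall>(M :: 'w measure) F Q R W X0 X.
          filtered_prob_space M F \<and>
          covariance_operator Q \<and> operator_sqrt R Q \<and> Q_wiener_process M F Q W \<and>
          X0 \<in> borel_measurable M \<and> (AE \<omega> in M. X0 \<omega> \<in> Hdot cls \<phi> lam \<beta>) \<and>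
          L2_norm M (Hdot_norm \<phi> lam \<beta>) X0 < \<top> \<and>
          HS_norm (Hdot_norm \<phi> lam (\<beta> - 2)) R < \<top> \<and>
          mild_solution \<phi> lam M F R W X0 X
          \<longrightarrow> (\<forall>t\<ge>0. L2_norm M (Hdot_norm \<phi> lam \<beta>) (X t)
                \<le> ennreal C * (L2_norm M (Hdot_norm \<phi> lam \<beta>) X0
                               + HS_norm (Hdot_norm \<phi> lam (\<beta> - 2)) R))) \<and>
     (\<forall>Q R. covariance_operator Q \<and> operator_sqrt R Q \<and>
            HS_norm (Hdot_norm \<phi> lam (-2)) R < \<top> \<longrightarrow>
        (\<exists>C::real.
          \<forall>(M :: 'w measure) F W X0 X.
            filtered_prob_space M F \<and> Q_wiener_process M F Q W \<and>
            X0 \<in> borel_measurable M \<and> L2_norm M H_norm X0 < \<top> \<and>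
            mild_solution \<phi> lam M F R W X0 X
            \<longrightarrow> (\<forall>t\<ge>0. L2_norm M H_norm (X t)
                  \<le> ennreal C * (L2_norm M H_norm X0
                                 + HS_norm (Hdot_norm \<phi> lam (-2)) R + ennreal (sqrt t)))))"
proof (intro conjI allI impI)
  fix \<beta> :: real
  show "\<exists>C::real. \<forall>(M :: 'w measure) F Q R W X0 X.
      filtered_prob_space M F \<and>
      covariance_operator Q \<and> operator_sqrt R Q \<and> Q_wiener_process M F Q W \<and>
      X0 \<in> borel_measurable M \<and> (AE \<omega> in M. X0 \<omega> \<in> Hdot cls \<phi> lam \<beta>) \<and>
      L2_norm M (Hdot_norm \<phi> lam \<beta>) X0 < \<top> \<and>
      HS_norm (Hdot_norm \<phi> lam (\<beta> - 2)) R < \<top> \<and>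
      mild_solution \<phi> lam M F R W X0 X
      \<longrightarrow> (\<forall>t\<ge>0. L2_norm M (Hdot_norm \<phi> lam \<beta>) (X t)
            \<le> ennreal C * (L2_norm M (Hdot_norm \<phi> lam \<beta>) X0
                           + HS_norm (Hdot_norm \<phi> lam (\<beta> - 2)) R))"
    by (intro exI[of _ 2] allI impI, elim conjE)
      (rule Hdot_stability[OF cylindrical_wienerI _ assms(4)])
next
  fix Q R :: "'h \<Rightarrow> 'h"
  assume "covariance_operator Q \<and> operator_sqrt R Q \<and> HS_norm (Hdot_norm \<phi> lam (-2)) R < \<top>"
  then show "\<exists>C::real. \<forall>(M :: 'w measure) F W X0 X.
      filtered_prob_space M F \<and> Q_wiener_process M F Q W \<and>
      X0 \<in> borel_measurable M \<and> L2_norm M H_norm X0 < \<top> \<and>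
      mild_solution \<phi> lam M F R W X0 X
      \<longrightarrow> (\<forall>t\<ge>0. L2_norm M H_norm (X t)
            \<le> ennreal C * (L2_norm M H_norm X0
                           + HS_norm (Hdot_norm \<phi> lam (-2)) R + ennreal (sqrt t)))"
    by (intro exI[of _ "sqrt (4 + 8 * (norm (R (\<phi> 0)))\<^sup>2)"] allI impI, elim conjE)
      (rule H_stability[OF cylindrical_wienerI _ assms(4)])
qed

end
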